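(* Let $k\ge1$ and let $W=\sum_{l\in\mathbb{Z}+\frac12}w(l+\frac k2,\hbar)E_{l+k,l}$ be a cut-and-join operator of fixed leakiness $k$ with $w(\frac s\hbar,\hbar)=\frac1\hbar\bar w(s)+O(\hbar)$, where $\bar w$ is an analytic function on $\mathbb{C}$ with $\bar w(0)=0$. Then the spectral curve is given by $$e^{x(z)}=X(z)=z\left(\frac{\bar w(S(z))}{\bar w\big(S(z)+k\,\bar w(S(z))z^k\big)}\right)^{\frac1k},\qquad y(z)=S(z)+k\,\bar w(S(z))\,z^k,$$ i.e. $\omega_{0,1}(X(z))=y(z)\frac{dX(z)}{X(z)}$. (The $k$-th root is the branch near $1$, so that $X(z)=z(1+O(z))$.)
   Context: **Fock space.** Let $\Lambda=\mathbb{C}[p_1,p_2,\dots]$; for $j>0$ let $J_j=j\,\partial/\partial p_j$ and let $J_{-j}$ be multiplication by $p_j$. For an operator $A$ on $\Lambda$, $\langle A\rangle$ is the constant term of $A\cdot 1$. Let $\varsigma(u)=e^{u/2}-e^{-u/2}$. For $n\in\mathbb{Z}$, $$\mathcal{E}_n(u)=\frac{1}{\varsigma(u)}\sum_{N\ge 0}\frac{1}{N!}\sum_{\substack{j_1,\dots,j_N\in\mathbb{Z}\setminus\{0\}\\ j_1+\dots+j_N=n}}\ \prod_{i=1}^N\frac{\varsigma(j_iu)}{j_i}\ {:}J_{j_1}\cdots J_{j_N}{:}$$ where ${:}\ {:}$ moves all $J_j$ with $j<0$ to the left. For $r\ge 0$, $\mathcal{F}_r^k$ is $r!$ times the coefficient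 of $u^r$ in $\mathcal{E}_{-k}(u)$. **Cut-and-join operator.** $w(j,\hbar)=\sum_{r\ge0}w_r(\hbar)j^r$ satisfies the standing assumption $w(\frac s\hbar,\hbar)\in\hbar^{-1}\mathbb{C}[[s,\hbar^2]]$; the $E_{ij}$ are the standard generators of the central extension $\widehat{\mathfrak a}_\infty$ of infinite matrices, and $W$ acts on $\Lambda$ as $\sum_{r\ge0}w_r(\hbar)\mathcal{F}_r^k$. $S(z)=\sum_{q\ge1}s_qz^q$ with $s_q$ numbers or formal variables. **Multidifferential.** $\omega_{0,1}(X)$ is the coefficient of $\hbar^{-1}$ in $\omega_1(X)=\sum_{m\ge1}X^m\frac{dX}X\big\langle J_me^We^{\sum_{q\ge1}s_qJ_{-q}/(q\hbar)}\big\rangle$. The ratio $\bar w(s)/\bar w(s+k\bar w(s)z^k)$ is understood after cancelling the common factor $\bar w(s)$, so that it equals $1$ at $z=0$. *)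

theory Defs
  imports
    "HOL-Complex_Analysis.Complex_Analysis"
    "HOL-Library.Multiset"
    "HOL-Library.Groups_Big_Fun"
begin

text \<open>
  All infinite sums below are either sums of finitely supported families (\<^const>\<open>Sum_any\<close>) or
  \<^const>\<open>suminf\<close> for the adic metric that the libraries put on \<open>fps\<close> and \<open>fls\<close>.
\<close>

section \<open>The completed Fock space\<close>

text \<open>
  The element \<open>e\<^sup>W e\<^sup>P \<cdot> 1\<close> lies in the completion of \<open>\<Lambda>\<close> by formal series in \<open>p\<^sub>1, p\<^sub>2, \<dots>\<close>.
  Such a series is given by its coefficients: a multiset \<open>{#j\<^sub>1, \<dots>, j\<^sub>n#}\<close> stands for the
  monomial \<open>p\<^bsub>j\<^sub>1\<^esub> \<cdots> p\<^bsub>j\<^sub>n\<^esub>\<close>. There is no \<open>p\<^sub>0\<close>; multisets containing \<open>0\<close> are never reached from \<open>1\<close>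
  by the operators below.
\<close>

type_synonym 'c fock = "nat multiset \<Rightarrow> 'c"

definition vacuum :: "'c::zero_neq_one fock" where
  "vacuum \<mu> = (if \<mu> = {#} then 1 else 0)"

definition vev :: "('c::zero_neq_one fock \<Rightarrow> 'c fock) \<Rightarrow> 'c" where
  "vev A = A vacuum {#}"

definition J :: "int \<Rightarrow> 'c::comm_ring_1 fock \<Rightarrow> 'c fock" where
  "J j f \<mu> =
     (if j < 0 then (if nat (- j) \<in># \<mu> then f (\<mu> - {#nat (- j)#}) else 0)
      else of_int j * of_nat (Suc (count \<mu> (nat j))) * f (add_mset (nat j) \<mu>))"

definition normal_ordered :: "int list \<Rightarrow> 'c::comm_ring_1 fock \<Rightarrow> 'c fock" where
  "normal_ordered js = foldr J (filter (\<lambda>j. j < 0) js @ filter (\<lambda>j. 0 < j) js)"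

definition op_exp :: "('c fock \<Rightarrow> 'c fock) \<Rightarrow> 'c::{field_char_0,metric_space} fock \<Rightarrow> 'c fock" where
  "op_exp A f \<mu> = suminf (\<lambda>n. (A ^^ n) f \<mu> / fact n)"


section \<open>The operators \<open>\<E>\<^sub>n(u)\<close> and \<open>\<F>\<^sub>r\<^sup>k\<close>\<close>

text \<open>\<open>varsigma a\<close> is the series \<open>\<varsigma>(a u)\<close> in \<open>u\<close>.\<close>

definition varsigma :: "'c::field_char_0 \<Rightarrow> 'c fps" where
  "varsigma a = fps_exp (a / 2) - fps_exp (- (a / 2))"

text \<open>
  The coefficient of \<open>\<mu>\<close> in \<open>\<E>\<^sub>n(u) f\<close>, a Laurent series in \<open>u\<close>. For fixed \<open>N\<close>, \<open>f\<close> and \<open>\<mu>\<close> only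
  finitely many tuples contribute: the negative entries of such a tuple form a sub-multiset of
  \<open>\<mu>\<close>, and this bounds the positive ones because the total is \<open>n\<close>. The \<open>N\<close>-th term is divisible
  by \<open>u\<^sup>N\<close> before the division by \<open>\<varsigma>(u)\<close>.
\<close>

definition E_op :: "int \<Rightarrow> 'c::field_char_0 fock \<Rightarrow> nat multiset \<Rightarrow> 'c fls" where
  "E_op n f \<mu> =
     1 / fps_to_fls (varsigma 1) *
     suminf (\<lambda>N. fls_const (1 / fact N) *
       Sum_any (\<lambda>js :: int list.
         if length js = N \<and> 0 \<notin> set js \<and> sum_list js = n
         then fps_to_fls (\<Prod>j\<leftarrow>js. fps_const (1 / of_int j) * varsigma (of_int j))
                * fls_const (normal_ordered js f \<mu>)
         else 0))"

definition F_op :: "nat \<Rightarrow> nat \<Rightarrow> 'c::field_char_0 fock \<Rightarrow> 'c fock" where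
  "F_op r k f \<mu> = fact r * fls_nth (E_op (- int k) f \<mu>) (int r)"


section \<open>The cut-and-join operator and \<open>\<omega>\<^bsub>0,1\<^esub>\<close>\<close>

text \<open>
  The parameters \<open>s\<^sub>q\<close> live in a field \<open>'a\<close> of characteristic zero together with a ring
  homomorphism \<open>\<iota>\<close> from the complex numbers. Numbers correspond to \<open>'a = complex\<close> and the identity,
  formal variables to the field of rational functions over the complex numbers in the \<open>s\<^sub>q\<close>. The
  ring of scalars is \<open>'a fls\<close>, Laurent series in \<open>\<hbar>\<close>.
\<close>

definition fps_map :: "('b::zero \<Rightarrow> 'c::zero) \<Rightarrow> 'b fps \<Rightarrow> 'c fps" where
  "fps_map h f = Abs_fps (\<lambda>n. h (fps_nth f n))"

definition fls_map :: "('b::zero \<Rightarrow> 'c::zero) \<Rightarrow> 'b fls \<Rightarrow> 'c fls" where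
  "fls_map h f = Abs_fls (\<lambda>n. h (fls_nth f n))"

lemma fls_map_nth:
  assumes "h 0 = 0"
  shows "fls_nth (fls_map h f) n = h (fls_nth f n)"
proof -
  have "h (fls_nth f m) = 0" if "m < fls_subdegree f" for m
    using that assms by simp
  then show ?thesis
    unfolding fls_map_def by (intro nth_Abs_fls_lower_bound) blast
qed

text \<open>
  The symbol \<open>w(j,\<hbar>) = \<Sum>\<^sub>r w\<^sub>r(\<hbar>) j\<^sup>r\<close> is the family \<open>w\<close> of its coefficients;
  \<open>rescaled_symbol w\<close> is \<open>w(s/\<hbar>,\<hbar>)\<close> as a series in \<open>s\<close> over Laurent series in \<open>\<hbar>\<close>.
\<close>

definition rescaled_symbol :: "(nat \<Rightarrow> complex fls) \<Rightarrow> complex fls fps" where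
  "rescaled_symbol w = Abs_fps (\<lambda>r. w r / fls_X ^ r)"

text \<open>\<open>w(s/\<hbar>,\<hbar>) \<in> \<hbar>\<^sup>-\<^sup>1 \<complex>[[s,\<hbar>\<^sup>2]]\<close>\<close>

definition admissible_symbol :: "(nat \<Rightarrow> complex fls) \<Rightarrow> bool" where
  "admissible_symbol w \<longleftrightarrow>
     (\<forall>r. \<exists>A :: complex fps.
        fps_nth (rescaled_symbol w) r = fps_to_fls (fps_compose A (fps_X\<^sup>2)) / fls_X)"

text \<open>\<open>w(s/\<hbar>,\<hbar>) = \<hbar>\<^sup>-\<^sup>1 wbar(s) + O(\<hbar>)\<close>, where \<open>wbar(s)\<close> is read as its Taylor series at \<open>0\<close>\<close>

definition leading_symbol :: "(nat \<Rightarrow> complex fls) \<Rightarrow> (complex \<Rightarrow> complex) \<Rightarrow> bool" where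
  "leading_symbol w wbar \<longleftrightarrow>
     (\<forall>r. \<exists>B :: complex fps.
        fps_nth (rescaled_symbol w) r =
          fls_const (fps_nth (fps_expansion wbar 0) r) / fls_X + fls_X * fps_to_fls B)"

text \<open>
  The action of \<open>W = \<Sum>\<^sub>l w(l + k/2, \<hbar>) E\<^bsub>l+k,l\<^esub>\<close>, \<open>l\<close> half-integral: by the boson-fermion
  correspondence \<open>\<E>\<^bsub>-k\<^esub>(u) = \<Sum>\<^sub>l e\<^bsup>u (l + k/2)\<^esup> E\<^bsub>l+k,l\<^esub>\<close> for \<open>k \<noteq> 0\<close>, hence
  \<open>\<F>\<^sub>r\<^sup>k = \<Sum>\<^sub>l (l + k/2)\<^sup>r E\<^bsub>l+k,l\<^esub>\<close>. The sum over \<open>r\<close> converges \<open>\<hbar>\<close>-adically for admissible symbols.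
\<close>

definition cut_and_join ::
    "(complex \<Rightarrow> 'a::field_char_0) \<Rightarrow> (nat \<Rightarrow> complex fls) \<Rightarrow> nat \<Rightarrow> 'a fls fock \<Rightarrow> 'a fls fock" where
  "cut_and_join \<iota> w k f \<mu> = suminf (\<lambda>r. fls_map \<iota> (w r) * F_op r k f \<mu>)"

text \<open>\<open>\<Sum>\<^bsub>q \<ge> 1\<^esub> s\<^sub>q J\<^bsub>-q\<^esub> / (q \<hbar>)\<close>\<close>

definition source :: "(nat \<Rightarrow> 'a::field_char_0) \<Rightarrow> 'a fls fock \<Rightarrow> 'a fls fock" where
  "source s f \<mu> =
     suminf (\<lambda>i. let q = Suc i in fls_const (s q) / (of_nat q * fls_X) * J (- int q) f \<mu>)"

text \<open>The coefficient of \<open>X\<^sup>m dX/X\<close> in \<open>\<omega>\<^sub>1(X)\<close>.\<close>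

definition omega1_coeff ::
    "(complex \<Rightarrow> 'a::field_char_0) \<Rightarrow> (nat \<Rightarrow> complex fls) \<Rightarrow> nat \<Rightarrow> (nat \<Rightarrow> 'a) \<Rightarrow> nat \<Rightarrow> 'a fls" where
  "omega1_coeff \<iota> w k s m =
     vev (J (int m) \<circ> op_exp (cut_and_join \<iota> w k) \<circ> op_exp (source s))"

text \<open>
  A formal one-form \<open>h(X) dX\<close> is represented by its density \<open>h\<close>, a Laurent series.
\<close>

definition omega01 ::
    "(complex \<Rightarrow> 'a::field_char_0) \<Rightarrow> (nat \<Rightarrow> complex fls) \<Rightarrow> nat \<Rightarrow> (nat \<Rightarrow> 'a) \<Rightarrow> 'a fls" where
  "omega01 \<iota> w k s =
     fps_to_fls (Abs_fps (\<lambda>m. if m = 0 then 0 else fls_nth (omega1_coeff \<iota> w k s m) (-1))) / fls_X"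

definition form_pullback :: "'a::field fls \<Rightarrow> 'a fps \<Rightarrow> 'a fls" where
  "form_pullback h X = fls_compose_fps h X * fps_to_fls (fps_deriv X)"

definition dlog_form :: "'a::field fps \<Rightarrow> 'a fls" where
  "dlog_form X = fps_to_fls (fps_deriv X) / fps_to_fls X"


section \<open>The spectral curve\<close>

definition S_series :: "(nat \<Rightarrow> 'a::zero) \<Rightarrow> 'a fps" where
  "S_series s = Abs_fps (\<lambda>q. if q = 0 then 0 else s q)"

definition curve_y :: "'a::field_char_0 fps \<Rightarrow> nat \<Rightarrow> 'a fps \<Rightarrow> 'a fps" where
  "curve_y w k S = S + of_nat k * fps_compose w S * fps_X ^ k"

text \<open>
  By Taylor's formula, \<open>w(s + k w(s) z\<^sup>k) = \<Sum>\<^sub>n (k z\<^sup>k)\<^sup>n w(s)\<^sup>n w\<^sup>(\<^sup>n\<^sup>)(s)/n!\<close>. Dividing each term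
  by \<open>w(s)\<close> and then setting \<open>s = S(z)\<close> gives the following series, to which
  \<open>w(S + k w(S) z\<^sup>k) / w(S)\<close> is equal whenever this makes sense; see \<open>cancelled_denominator_mult\<close>.
\<close>

definition cancelled_denominator :: "'a::field_char_0 fps \<Rightarrow> nat \<Rightarrow> 'a fps \<Rightarrow> 'a fps" where
  "cancelled_denominator w k S =
     suminf (\<lambda>n. if n = 0 then 1
       else fps_const (of_nat k ^ n / fact n) * fps_X ^ (k * n)
              * fps_compose w S ^ (n - 1) * fps_compose ((fps_deriv ^^ n) w) S)"

lemma suminf_fps_nth:
  fixes g :: "nat \<Rightarrow> 'a::comm_ring_1 fps"
  assumes g: "\<And>n i. i < n \<Longrightarrow> fps_nth (g n) i = 0" and "m \<le> M"
  shows "fps_nth (suminf g) m = (\<Sum>n\<le>M. fps_nth (g n) m)"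
proof -
  define F where "F = Abs_fps (\<lambda>m. \<Sum>n\<le>m. fps_nth (g n) m)"
  have *: "(\<Sum>n\<in>{..<N}. fps_nth (g n) i) = (\<Sum>n\<le>i. fps_nth (g n) i)" if "Suc i \<le> N" for N i
    using that g by (intro sum.mono_neutral_right) auto
  have "g sums F"
    unfolding sums_def
  proof (rule tendsto_fpsI)
    fix i
    show "\<forall>\<^sub>F N in sequentially. fps_nth (sum g {..<N}) i = fps_nth F i"
      using eventually_ge_at_top[of "Suc i"]
      by eventually_elim (simp add: fps_sum_nth F_def *)
  qed
  then have "fps_nth (suminf g) m = (\<Sum>n\<le>m. fps_nth (g n) m)"
    by (simp add: sums_iff F_def)
  also have "\<dots> = (\<Sum>n\<le>M. fps_nth (g n) m)"
    using *[of m "Suc M"] assms(2) by (simp add: lessThan_Suc_atMost)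
  finally show ?thesis .
qed

lemma fps_mult_suminf:
  fixes g :: "nat \<Rightarrow> 'a::comm_ring_1 fps"
  assumes g: "\<And>n i. i < n \<Longrightarrow> fps_nth (g n) i = 0"
  shows "suminf g * c = suminf (\<lambda>n. g n * c)"
proof (rule fps_ext)
  fix m
  have g': "fps_nth (g n * c) i = 0" if "i < n" for n i
    using that g by (auto simp: fps_mult_nth intro!: sum.neutral)
  have "fps_nth (suminf g * c) m = (\<Sum>i=0..m. (\<Sum>n\<le>m. fps_nth (g n) i) * fps_nth c (m - i))"
    unfolding fps_mult_nth by (intro sum.cong refl) (simp add: suminf_fps_nth[OF g])
  also have "\<dots> = (\<Sum>n\<le>m. fps_nth (g n * c) m)"
    unfolding fps_mult_nth sum_distrib_right by (rule sum.swap)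
  also have "\<dots> = fps_nth (suminf (\<lambda>n. g n * c)) m"
    using suminf_fps_nth[of "\<lambda>n. g n * c", OF g' order.refl] by simp
  finally show "fps_nth (suminf g * c) m = fps_nth (suminf (\<lambda>n. g n * c)) m" .
qed

lemma fps_mult_power_nth_eq_0:
  fixes S h :: "'a::comm_ring_1 fps"
  assumes "fps_nth S 0 = 0" "fps_nth h 0 = 0" "m < n + i"
  shows "fps_nth (h ^ n * S ^ i) m = 0"
  unfolding fps_mult_nth
proof (rule sum.neutral, rule ballI)
  fix j assume "j \<in> {0..m}"
  then have "j < n \<or> m - j < i" using assms(3) by auto
  then show "fps_nth (h ^ n) j * fps_nth (S ^ i) (m - j) = 0"
    using startsby_zero_power_prefix[OF assms(1)] startsby_zero_power_prefix[OF assms(2)] by auto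
qed

lemma fps_mult_compose_nth:
  fixes f S h :: "'a::comm_ring_1 fps"
  assumes S: "fps_nth S 0 = 0"
  shows "fps_nth (h * fps_compose f S) m = (\<Sum>i\<le>m. fps_nth f i * fps_nth (h * S ^ i) m)"
proof -
  have "fps_nth (fps_compose f S) j = (\<Sum>i\<le>m. fps_nth f i * fps_nth (S ^ i) j)" if "j \<le> m" for j
    unfolding fps_compose_nth
    using that startsby_zero_power_prefix[OF S] by (intro sum.mono_neutral_left) auto
  then have "fps_nth (h * fps_compose f S) m =
      (\<Sum>j=0..m. \<Sum>i\<le>m. fps_nth h j * (fps_nth f i * fps_nth (S ^ i) (m - j)))"
    unfolding fps_mult_nth by (intro sum.cong refl) (simp add: sum_distrib_left)
  also have "\<dots> = (\<Sum>i\<le>m. \<Sum>j=0..m. fps_nth h j * (fps_nth f i * fps_nth (S ^ i) (m - j)))"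
    by (rule sum.swap)
  also have "\<dots> = (\<Sum>i\<le>m. fps_nth f i * fps_nth (h * S ^ i) m)"
    unfolding fps_mult_nth sum_distrib_left by (intro sum.cong refl) (simp add: algebra_simps)
  finally show ?thesis .
qed

lemma fps_deriv_funpow_nth:
  fixes f :: "'a::field_char_0 fps"
  shows "fps_nth ((fps_deriv ^^ n) f) i = fact (n + i) / fact i * fps_nth f (n + i)"
proof (induction n arbitrary: i)
  case (Suc n)
  have "fps_nth ((fps_deriv ^^ Suc n) f) i = of_nat (Suc i) * (fact (n + Suc i) / fact (Suc i) * fps_nth f (n + Suc i))"
    by (simp add: Suc.IH)
  also have "\<dots> = fact (Suc n + i) / fact i * fps_nth f (Suc n + i)"
    by (simp add: fact_Suc[of i] del: of_nat_Suc)
  finally show ?case .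
qed simp

lemma fps_taylor:
  fixes f S h :: "'a::field_char_0 fps"
  assumes S: "fps_nth S 0 = 0" and h: "fps_nth h 0 = 0"
  shows "suminf (\<lambda>n. fps_const (1 / fact n) * h ^ n * fps_compose ((fps_deriv ^^ n) f) S)
           = fps_compose f (S + h)" (is "suminf ?T = _")
proof (rule fps_ext)
  fix m
  have T: "fps_nth (?T n) m = (\<Sum>i\<le>m. of_nat ((n + i) choose n) * fps_nth f (n + i) * fps_nth (h ^ n * S ^ i) m)" for n m
  proof -
    have "fps_nth (?T n) m = 1 / fact n * fps_nth (h ^ n * fps_compose ((fps_deriv ^^ n) f) S) m"
      by (simp add: mult.assoc)
    also have "\<dots> = (\<Sum>i\<le>m. 1 / fact n * (fact (n + i) / fact i * fps_nth f (n + i) * fps_nth (h ^ n * S ^ i) m))"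
      by (simp add: fps_mult_compose_nth[OF S] fps_deriv_funpow_nth sum_distrib_left)
    also have "\<dots> = (\<Sum>i\<le>m. of_nat ((n + i) choose n) * fps_nth f (n + i) * fps_nth (h ^ n * S ^ i) m)"
      by (intro sum.cong refl) (simp add: binomial_fact field_simps)
    finally show ?thesis .
  qed
  have T0: "fps_nth (?T n) i = 0" if "i < n" for n i
    unfolding T using that by (intro sum.neutral) (auto simp: fps_mult_power_nth_eq_0[OF S h])
  let ?F = "\<lambda>n i. of_nat ((n + i) choose n) * fps_nth f (n + i) * fps_nth (h ^ n * S ^ i) m"
  have nz: "n + i \<le> m" if "fps_nth (h ^ n * S ^ i) m \<noteq> 0" for n i
    using that fps_mult_power_nth_eq_0[OF S h, of m n i] by (meson not_le)
  have "fps_nth (suminf ?T) m = (\<Sum>n\<le>m. \<Sum>i\<le>m. ?F n i)"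
    by (simp only: suminf_fps_nth[OF T0 order.refl] T)
  also have "\<dots> = (\<Sum>(n, i)\<in>{..m} \<times> {..m}. ?F n i)"
    by (simp add: sum.cartesian_product)
  also have "\<dots> = (\<Sum>(n, i)\<in>{(n, i). n + i \<le> m}. ?F n i)"
    using nz by (intro sum.mono_neutral_right) auto
  also have "\<dots> = (\<Sum>p\<le>m. \<Sum>n\<le>p. ?F n (p - n))"
    by (rule sum.triangle_reindex_eq)
  also have "\<dots> = (\<Sum>p\<le>m. fps_nth f p * fps_nth ((S + h) ^ p) m)"
  proof (intro sum.cong refl)
    fix p
    have "(S + h) ^ p = (\<Sum>n\<le>p. of_nat (p choose n) * h ^ n * S ^ (p - n))"
      by (subst add.commute) (rule binomial_ring)
    then have "fps_nth ((S + h) ^ p) m = (\<Sum>n\<le>p. of_nat (p choose n) * fps_nth (h ^ n * S ^ (p - n)) m)"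
      by (simp add: fps_sum_nth mult.assoc flip: fps_of_nat)
    then show "(\<Sum>n\<le>p. ?F n (p - n)) = fps_nth f p * fps_nth ((S + h) ^ p) m"
      by (simp add: sum_distrib_left algebra_simps)
  qed
  also have "\<dots> = fps_nth (fps_compose f (S + h)) m"
    by (simp add: fps_compose_nth atLeast0AtMost)
  finally show "fps_nth (suminf ?T) m = fps_nth (fps_compose f (S + h)) m" .
qed

lemma
  fixes w S :: "'a::field_char_0 fps"
  assumes S: "fps_nth S 0 = 0" and k: "k \<ge> 1"
  shows cancelled_denominator_mult:
      "fps_compose w S * cancelled_denominator w k S = fps_compose w (curve_y w k S)"
    and cancelled_denominator_nth_0: "fps_nth (cancelled_denominator w k S) 0 = 1"
proof -
  define v where "v = fps_compose w S"
  define g where "g = (\<lambda>n. if n = 0 then 1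
       else fps_const (of_nat k ^ n / fact n) * fps_X ^ (k * n)
              * v ^ (n - 1) * fps_compose ((fps_deriv ^^ n) w) S)"
  have g: "fps_nth (g n) i = 0" if "i < n" for n i
  proof -
    have "i < k * n" using that k by (cases k) auto
    then show ?thesis
      using that by (simp add: g_def mult.assoc fps_X_power_mult_nth)
  qed
  have U: "cancelled_denominator w k S = suminf g"
    unfolding cancelled_denominator_def g_def v_def ..
  show "fps_nth (cancelled_denominator w k S) 0 = 1"
    unfolding U using suminf_fps_nth[of g 0 0, OF g] by (simp add: g_def)
  define h where "h = of_nat k * v * fps_X ^ k"
  have "g n * v = fps_const (1 / fact n) * h ^ n * fps_compose ((fps_deriv ^^ n) w) S" for n
  proof (cases "n = 0")
    case True
    then show ?thesis by (simp add: g_def v_def)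
  next
    case False
    have "fps_const (of_nat k ^ n / fact n) = fps_const (1 / fact n) * (of_nat k ^ n :: 'a fps)"
      by (simp flip: fps_of_nat)
    moreover have "v ^ n = v ^ (n - 1) * v" using False by (metis power_minus_mult neq0_conv)
    ultimately show ?thesis
      using False by (simp add: g_def h_def power_mult_distrib power_mult mult_ac)
  qed
  moreover have "fps_nth h 0 = 0"
    using k by (simp add: h_def)
  ultimately show "fps_compose w S * cancelled_denominator w k S = fps_compose w (curve_y w k S)"
    unfolding v_def[symmetric] U
    by (subst mult.commute) (simp add: fps_mult_suminf[OF g] fps_taylor[OF S] curve_y_def h_def v_def)
qed

text \<open>The root of a series with constant term \<open>1\<close> that again has constant term \<open>1\<close>.\<close>

definition curve_X :: "'a::field_char_0 fps \<Rightarrow> nat \<Rightarrow> 'a fps \<Rightarrow> 'a fps" where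
  "curve_X w k S = fps_X * fps_radical (\<lambda>_ _. 1) k (1 / cancelled_denominator w k S)"

lemma
  fixes w S :: "'a::field_char_0 fps"
  assumes S: "fps_nth S 0 = 0" and k: "k \<ge> 1"
  shows curve_X_power: "curve_X w k S ^ k * cancelled_denominator w k S = fps_X ^ k"
    and curve_X_nth_0: "fps_nth (curve_X w k S) 0 = 0"
    and curve_X_nth_1: "fps_nth (curve_X w k S) 1 = 1"
proof -
  let ?U = "cancelled_denominator w k S"
  have U0: "fps_nth ?U 0 = 1" using cancelled_denominator_nth_0[OF S k] .
  have inv: "1 / ?U = inverse ?U" using U0 by (simp add: fps_divide_unit)
  obtain k' where k': "k = Suc k'" using k by (cases k) auto
  have "fps_radical (\<lambda>_ _. 1) k (inverse ?U) ^ k = inverse ?U"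
    using U0 unfolding k' by (subst power_radical[symmetric]) auto
  then show "curve_X w k S ^ k * ?U = fps_X ^ k"
    using U0 by (simp add: curve_X_def inv power_mult_distrib mult.assoc inverse_mult_eq_1)
  show "fps_nth (curve_X w k S) 0 = 0" "fps_nth (curve_X w k S) 1 = 1"
    using k by (simp_all add: curve_X_def)
qed

end

theory Submission
  imports Defs
begin

text \<open>
  Give every \<open>p\<^sub>j\<close> the weight \<open>\<hbar>\<close>. The terms of lowest weight of \<open>exp (\<Sum>\<^sub>q s\<^sub>q p\<^sub>q / (q \<hbar>))\<close> form the coherent
  state \<open>exp (\<Sum>\<^sub>i \<phi>\<^sub>i p\<^sub>i / i)\<close> with \<open>\<phi> = S\<close>, and to lowest weight \<open>W\<close> acts as the operator
  \<open>\<Sum>\<^sub>j p\<^sub>j [z\<^bsup>j-k\<^esup>] wbar(\<Sum>\<^sub>i J\<^sub>i z\<^sup>i)\<close>, which is of first order in the \<open>p\<^sub>j\<close>. As \<open>J\<^sub>i\<close> multiplies a coherent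
  state by \<open>\<phi>\<^sub>i\<close>, the flow \<open>e\<^bsup>t W\<^esup>\<close> carries coherent states to coherent states, and \<open>\<phi>(t, X)\<close> solves
  \<open>\<partial>\<^sub>t \<phi> = X \<partial>\<^sub>X (X\<^sup>k wbar(\<phi>))\<close> with \<open>\<phi>(0, X) = S(X)\<close>. Its value at \<open>t = 1\<close> is \<open>\<omega>\<^bsub>0,1\<^esub>\<close>.

  This equation is solved by characteristics. Let \<open>Z\<close> solve the linear transport equation
  \<open>\<partial>\<^sub>t Z = X\<^sup>k wbar'(\<phi>) X \<partial>\<^sub>X Z\<close> with \<open>Z(0, X) = X\<close>. Any other solution is a function of \<open>Z\<close>, determined
  by its value at \<open>t = 0\<close>; both \<open>H = X\<^sup>k wbar(\<phi>)\<close> and \<open>\<phi> - t k H\<close> are solutions. At \<open>t = 1\<close> this gives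
  \<open>\<phi> = S(Z) + k H\<close> and \<open>X\<^sup>k wbar(\<phi>) = Z\<^sup>k wbar(S(Z))\<close>, which is the spectral curve with \<open>z = Z\<close>.
\<close>

section \<open>Characteristics\<close>

lemma fps_nth_fps_map [simp]: "fps_nth (fps_map h f) n = h (fps_nth f n)"
  by (simp add: fps_map_def)

lemma fps_fixpoint_exists:
  fixes T :: "'b::zero fps \<Rightarrow> 'b fps"
  assumes T: "\<And>f g n. (\<And>i. i < n \<Longrightarrow> fps_nth f i = fps_nth g i) \<Longrightarrow> fps_nth (T f) n = fps_nth (T g) n"
  shows "\<exists>f. T f = f"
proof -
  define f where "f = Abs_fps (\<lambda>m. fps_nth ((T ^^ Suc m) 0) m)"
  have stable: "fps_nth ((T ^^ (Suc i + j)) 0) i = fps_nth ((T ^^ Suc i) 0) i" for i j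
  proof (induction i arbitrary: j rule: less_induct)
    case (less i)
    have "fps_nth ((T ^^ (i + j)) 0) l = fps_nth ((T ^^ i) 0) l" if "l < i" for l
      using less.IH[OF that, of "i + j - Suc l"] less.IH[OF that, of "i - Suc l"] that by simp
    then show ?case
      using T[of i "(T ^^ (i + j)) 0" "(T ^^ i) 0"] by simp
  qed
  have "fps_nth (T f) n = fps_nth f n" for n
  proof -
    have "fps_nth f i = fps_nth ((T ^^ n) 0) i" if "i < n" for i
      using stable[of i "n - Suc i"] that by (simp add: f_def)
    then show ?thesis
      using T[of n f "(T ^^ n) 0"] by (simp add: f_def)
  qed
  then show ?thesis
    by (auto intro: fps_ext)
qed

lemma pderiv_sum: "pderiv (sum f A) = (\<Sum>i\<in>A. pderiv (f i))"
  by (induction A rule: infinite_finite_induct) (simp_all add: pderiv_add)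

lemma pderiv_surj: "\<exists>q. pderiv q = (p :: 'a::field_char_0 poly) \<and> poly q 0 = 0"
proof -
  define q where "q = (\<Sum>i\<le>degree p. monom (coeff p i / of_nat (Suc i)) (Suc i))"
  have "pderiv q = (\<Sum>i\<le>degree p. monom (coeff p i) i)"
    unfolding q_def pderiv_sum by (intro sum.cong refl) (simp add: pderiv_monom del: of_nat_Suc)
  then have "pderiv q = p"
    by (simp add: poly_as_sum_of_monoms)
  moreover have "poly q 0 = 0"
    by (simp add: q_def poly_sum poly_monom)
  ultimately show ?thesis by blast
qed

definition poly_integral :: "'a::field_char_0 poly \<Rightarrow> 'a poly" where
  "poly_integral p = (SOME q. pderiv q = p \<and> poly q 0 = 0)"

lemma pderiv_poly_integral [simp]: "pderiv (poly_integral p) = p"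
  and poly_integral_0 [simp]: "poly (poly_integral p) 0 = 0"
  using someI_ex[OF pderiv_surj[of p]] by (simp_all add: poly_integral_def)

lemma poly_eq_0I_pderiv:
  fixes p :: "'a::field_char_0 poly"
  assumes "pderiv p = 0" "poly p 0 = 0"
  shows "p = 0"
proof -
  obtain c where "p = [:c:]"
    using assms(1) by (metis degree_eq_zeroE pderiv_eq_0_iff)
  with assms(2) show ?thesis by simp
qed

lemma poly_integral_of_0 [simp]: "poly_integral 0 = 0"
  by (rule poly_eq_0I_pderiv) simp_all

text \<open>
  A series over \<open>'a poly\<close> is a family of series in \<open>X\<close> depending polynomially on the time \<open>t\<close>.
\<close>

abbreviation lift_fps :: "'a::comm_ring_1 fps \<Rightarrow> 'a poly fps" where
  "lift_fps \<equiv> fps_map (\<lambda>c. [:c:])"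

abbreviation at_time :: "'a::comm_ring_1 \<Rightarrow> 'a poly fps \<Rightarrow> 'a fps" where
  "at_time t \<equiv> fps_map (\<lambda>p. poly p t)"

abbreviation time_deriv :: "'a::field_char_0 poly fps \<Rightarrow> 'a poly fps" where
  "time_deriv \<equiv> fps_map pderiv"

definition euler_op :: "'b::comm_semiring_1 fps \<Rightarrow> 'b fps" where
  "euler_op f = fps_X * fps_deriv f"

lemma euler_op_nth [simp]: "fps_nth (euler_op f) n = of_nat n * fps_nth f n"
  by (cases n) (simp_all add: euler_op_def)

lemma euler_op_diff: "euler_op (f - g :: 'b::comm_ring_1 fps) = euler_op f - euler_op g"
  by (rule fps_ext) (simp add: algebra_simps)

lemma euler_op_mult: "euler_op (f * g :: 'b::comm_ring_1 fps) = euler_op f * g + f * euler_op g"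
  by (simp add: euler_op_def algebra_simps)

lemma euler_op_const_mult: "euler_op (fps_const c * f) = fps_const c * euler_op f"
  by (rule fps_ext) (simp add: algebra_simps)

lemma euler_op_X_power: "euler_op (fps_X ^ k :: 'b::comm_ring_1 fps) = of_nat k * fps_X ^ k"
  by (rule fps_ext) (simp add: fps_X_power_nth fps_mult_of_nat_nth)

lemma euler_op_compose:
  fixes F :: "'b::idom fps"
  assumes "fps_nth f 0 = 0"
  shows "euler_op (fps_compose F f) = fps_compose (fps_deriv F) f * euler_op f"
  by (simp add: euler_op_def fps_compose_deriv[OF assms] algebra_simps)

lemma time_deriv_diff: "time_deriv (f - g) = time_deriv f - time_deriv g"
  by (rule fps_ext) (simp add: pderiv_diff)

lemma time_deriv_mult: "time_deriv (f * g) = time_deriv f * g + f * time_deriv g"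
proof (rule fps_ext)
  fix n
  show "fps_nth (time_deriv (f * g)) n = fps_nth (time_deriv f * g + f * time_deriv g) n"
    unfolding fps_nth_fps_map fps_add_nth fps_mult_nth pderiv_sum pderiv_mult sum.distrib
    by (simp add: mult.commute add.commute)
qed

lemma time_deriv_X_power [simp]: "time_deriv (fps_X ^ k) = 0"
  by (rule fps_ext) (simp add: fps_X_power_nth pderiv_1)

lemma time_deriv_power: "time_deriv (f ^ Suc n) = of_nat (Suc n) * f ^ n * time_deriv f"
  by (induction n) (simp_all add: time_deriv_mult algebra_simps)

lemma fps_deriv_lift_fps: "fps_deriv (lift_fps F) = lift_fps (fps_deriv F)"
  by (rule fps_ext) (simp add: of_nat_poly)

lemma time_deriv_compose:
  assumes f: "fps_nth f 0 = 0"
  shows "time_deriv (fps_compose (lift_fps F) f) = fps_compose (lift_fps (fps_deriv F)) f * time_deriv f"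
proof (rule fps_ext)
  fix m
  let ?g = "time_deriv f"
  have "fps_nth (time_deriv (fps_compose (lift_fps F) f)) m
      = (\<Sum>i\<le>Suc m. [:fps_nth F i:] * fps_nth (time_deriv (f ^ i)) m)"
  proof -
    have "fps_nth (fps_compose (lift_fps F) f) m = (\<Sum>i\<le>Suc m. [:fps_nth F i:] * fps_nth (f ^ i) m)"
      unfolding fps_compose_nth
      using startsby_zero_power_prefix[OF f] by (intro sum.mono_neutral_cong_left) auto
    then show ?thesis
      by (simp add: pderiv_sum pderiv_smult del: sum.atMost_Suc)
  qed
  also have "\<dots> = (\<Sum>i\<le>m. [:fps_nth F (Suc i):] * fps_nth (time_deriv (f ^ Suc i)) m)"
    by (subst sum.atMost_Suc_shift) (simp add: pderiv_1)
  also have "\<dots> = (\<Sum>i\<le>m. fps_nth (lift_fps (fps_deriv F)) i * fps_nth (?g * f ^ i) m)"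
    unfolding time_deriv_power
    by (intro sum.cong refl)
       (simp add: of_nat_poly mult.assoc mult.commute[of ?g] fps_mult_of_nat_nth del: of_nat_Suc)
  also have "\<dots> = fps_nth (?g * fps_compose (lift_fps (fps_deriv F)) f) m"
    by (simp add: fps_mult_compose_nth[OF f])
  finally show "fps_nth (time_deriv (fps_compose (lift_fps F) f)) m
      = fps_nth (fps_compose (lift_fps (fps_deriv F)) f * time_deriv f) m"
    by (simp add: mult.commute)
qed

lemma at_time_diff: "at_time t (f - g) = at_time t f - at_time t g"
  by (rule fps_ext) simp

lemma at_time_mult: "at_time t (f * g) = at_time t f * at_time t g"
  by (rule fps_ext) (simp add: fps_mult_nth poly_sum)

lemma at_time_X_power [simp]: "at_time t (fps_X ^ k) = fps_X ^ k"
  by (rule fps_ext) (simp add: fps_X_power_nth)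

lemma at_time_power: "at_time t (f ^ k) = at_time t f ^ k"
proof (induction k)
  case 0
  show ?case using at_time_X_power[of t 0] by simp
qed (simp add: at_time_mult)

lemma at_time_compose: "at_time t (fps_compose (lift_fps F) f) = fps_compose F (at_time t f)"
proof (rule fps_ext)
  fix m
  have "poly (fps_nth (f ^ i) m) t = fps_nth (at_time t f ^ i) m" for i
    by (simp flip: at_time_power)
  then show "fps_nth (at_time t (fps_compose (lift_fps F) f)) m = fps_nth (fps_compose F (at_time t f)) m"
    by (simp add: fps_compose_nth poly_sum)
qed

section \<open>The linear transport equation\<close>

text \<open>As \<open>a\<close> has no constant term, coefficient \<open>n\<close> of
  \<open>a * euler_op f\<close> involves only coefficients of \<open>f\<close> below
  \<open>n\<close>. Inductively every coefficient has zero derivative and zero initial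
  value.\<close>

lemma transport_unique:
  fixes a f :: "'a::field_char_0 poly fps"
  assumes a: "fps_nth a 0 = 0" and f: "time_deriv f = a * euler_op f" and f0: "at_time 0 f = 0"
  shows "f = 0"
proof -
  have "fps_nth f n = 0" for n
  proof (induction n rule: less_induct)
    case (less n)
    have "pderiv (fps_nth f n) = fps_nth (time_deriv f) n"
      by simp
    also have "\<dots> = (\<Sum>i=0..n. fps_nth a i * (of_nat (n - i) * fps_nth f (n - i)))"
      unfolding f by (simp add: fps_mult_nth)
    also have "\<dots> = 0"
    proof (intro sum.neutral ballI)
      fix i assume "i \<in> {0..n}"
      then show "fps_nth a i * (of_nat (n - i) * fps_nth f (n - i)) = 0"
        using a less.IH[of "n - i"] by (cases "i = 0") auto
    qed
    finally have "pderiv (fps_nth f n) = 0" .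
    moreover have "poly (fps_nth f n) 0 = 0"
      using arg_cong[OF f0, of "\<lambda>g. fps_nth g n"] by simp
    ultimately show ?case
      by (rule poly_eq_0I_pderiv)
  qed
  then show ?thesis by (simp add: fps_eq_iff)
qed

text \<open>Picard iteration on the integrated equation, triangular because \<open>a\<close> has no
  constant term. The product \<open>a * euler_op Z\<close> starts in degree 2, since the Euler
  operator kills constants, so the first two coefficients remain those of
  \<open>fps_X\<close>.\<close>

lemma transport_exists:
  fixes a :: "'a::field_char_0 poly fps"
  assumes a: "fps_nth a 0 = 0"
  shows "\<exists>Z. time_deriv Z = a * euler_op Z \<and> at_time 0 Z = fps_X \<and> fps_nth Z 0 = 0 \<and> fps_nth Z 1 = 1"
proof -
  define T where "T = (\<lambda>Z. fps_X + fps_map poly_integral (a * euler_op Z))"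
  have "\<exists>Z. T Z = Z"
  proof (rule fps_fixpoint_exists)
    fix f g :: "'a poly fps" and n
    assume fg: "\<And>i. i < n \<Longrightarrow> fps_nth f i = fps_nth g i"
    have "fps_nth a i * (of_nat (n - i) * fps_nth f (n - i)) = fps_nth a i * (of_nat (n - i) * fps_nth g (n - i))"
      if "i \<le> n" for i
      using a fg[of "n - i"] that by (cases "i = 0") (auto simp: not_le)
    then have "fps_nth (a * euler_op f) n = fps_nth (a * euler_op g) n"
      unfolding fps_mult_nth euler_op_nth by (intro sum.cong) auto
    then show "fps_nth (T f) n = fps_nth (T g) n"
      by (simp add: T_def)
  qed
  then obtain Z where Z: "T Z = Z" by blast
  have Zn: "fps_nth Z n = fps_nth fps_X n + poly_integral (fps_nth (a * euler_op Z) n)" for n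
    by (subst Z[symmetric]) (simp add: T_def)
  have a_eq: "fps_nth (a * euler_op Z) n = 0" if "n \<le> 1" for n
    using that a by (cases n) (auto simp: fps_mult_nth_1)
  have "time_deriv Z = a * euler_op Z"
    by (rule fps_ext) (subst fps_nth_fps_map, subst Zn, simp add: pderiv_add pderiv_1)
  moreover have "at_time 0 Z = fps_X"
    by (rule fps_ext) (subst fps_nth_fps_map, subst Zn, simp)
  moreover have "fps_nth Z 0 = 0" "fps_nth Z 1 = 1"
    using Zn[of 0] Zn[of 1] a by (simp_all add: a_eq)
  ultimately show ?thesis by blast
qed

text \<open>By the chain rule, both derivatives of a function of \<open>Z\<close> acquire the same
  factor, so it solves the equation of \<open>Z\<close>. Since \<open>Z\<close> is
  \<open>fps_X\<close> at time \<open>0\<close>, the initial values agree and uniqueness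
  applies.\<close>

lemma transport_solution:
  fixes a f Z :: "'a::field_char_0 poly fps"
  assumes a: "fps_nth a 0 = 0" and f: "time_deriv f = a * euler_op f"
    and Z: "time_deriv Z = a * euler_op Z" "at_time 0 Z = fps_X" "fps_nth Z 0 = 0"
  shows "f = fps_compose (lift_fps (at_time 0 f)) Z"
proof -
  let ?g = "fps_compose (lift_fps (at_time 0 f)) Z"
  have "time_deriv ?g = a * euler_op ?g"
    by (simp add: time_deriv_compose[OF Z(3)] euler_op_compose[OF Z(3)] Z(1) fps_deriv_lift_fps mult_ac)
  then have "f - ?g = 0"
    using f by (intro transport_unique[OF a])
      (simp_all add: time_deriv_diff euler_op_diff algebra_simps at_time_diff at_time_compose Z(2))
  then show ?thesis by simp
qed

text \<open>The nonlinear flow of the opening comment: a conservation law of inviscid Burgers type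
  in the variable \<open>log X\<close>, in which \<open>euler_op\<close> is the derivative.\<close>

definition burgers_solution :: "'a::field_char_0 fps \<Rightarrow> nat \<Rightarrow> 'a fps \<Rightarrow> 'a poly fps \<Rightarrow> bool" where
  "burgers_solution b k S \<phi> \<longleftrightarrow>
     time_deriv \<phi> = euler_op (fps_X ^ k * fps_compose (lift_fps b) \<phi>) \<and>
     at_time 0 \<phi> = S \<and> fps_nth \<phi> 0 = 0"

lemma fps_compose_nth_cong:
  assumes "\<And>i. i \<le> n \<Longrightarrow> fps_nth f i = fps_nth g i"
  shows "fps_nth (fps_compose F f) n = fps_nth (fps_compose F g) n"
proof -
  have "fps_nth (f ^ i) m = fps_nth (g ^ i) m" if "m \<le> n" for i m
    using that
  proof (induction i arbitrary: m)
    case (Suc i)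
    show ?case
      unfolding power_Suc fps_mult_nth
      using Suc by (intro sum.cong refl arg_cong2[of _ _ _ _ "(*)"] assms) auto
  qed simp
  then show ?thesis by (simp add: fps_compose_nth)
qed

text \<open>The factor \<open>fps_X ^ k\<close> with \<open>k \<ge> 1\<close> shifts indices, so
  coefficient \<open>n\<close> of the right-hand side depends only on coefficients of \<phi> up to
  \<open>n - k\<close> and the integrated equation is triangular.\<close>

lemma burgers_solution_exists:
  fixes b S :: "'a::field_char_0 fps"
  assumes S: "fps_nth S 0 = 0" and k: "k \<ge> 1"
  shows "\<exists>\<phi>. burgers_solution b k S \<phi>"
proof -
  define T where "T = (\<lambda>\<phi>. lift_fps S + fps_map poly_integral (euler_op (fps_X ^ k * fps_compose (lift_fps b) \<phi>)))"
  have "\<exists>\<phi>. T \<phi> = \<phi>"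
  proof (rule fps_fixpoint_exists)
    fix f g :: "'a poly fps" and n
    assume fg: "\<And>i. i < n \<Longrightarrow> fps_nth f i = fps_nth g i"
    have "fps_nth (fps_compose (lift_fps b) f) (n - k) = fps_nth (fps_compose (lift_fps b) g) (n - k)" if "k \<le> n"
      using k that by (intro fps_compose_nth_cong fg) auto
    then show "fps_nth (T f) n = fps_nth (T g) n"
      by (simp add: T_def fps_X_power_mult_nth)
  qed
  then obtain \<phi> where \<phi>: "T \<phi> = \<phi>" by blast
  have \<phi>n: "fps_nth \<phi> n = [:fps_nth S n:] + poly_integral (fps_nth (euler_op (fps_X ^ k * fps_compose (lift_fps b) \<phi>)) n)" for n
    by (subst \<phi>[symmetric]) (simp add: T_def)
  have "time_deriv \<phi> = euler_op (fps_X ^ k * fps_compose (lift_fps b) \<phi>)"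
    by (rule fps_ext) (subst fps_nth_fps_map, subst \<phi>n, simp add: pderiv_add pderiv_pCons)
  moreover have "at_time 0 \<phi> = S"
    by (rule fps_ext) (simp, subst \<phi>n, simp)
  moreover have "fps_nth \<phi> 0 = 0"
    by (subst \<phi>n) (simp add: S)
  ultimately show ?thesis
    unfolding burgers_solution_def by blast
qed

lemma burgers_at_time_1:
  fixes b S :: "'a::field_char_0 fps"
  assumes sol: "burgers_solution b k S \<phi>" and k: "k \<ge> 1"
  defines "\<psi> \<equiv> at_time 1 \<phi>"
  obtains \<zeta> where "fps_nth \<zeta> 0 = 0" "fps_nth \<zeta> 1 = 1"
    "\<psi> = fps_compose S \<zeta> + of_nat k * (fps_X ^ k * fps_compose b \<psi>)"
    "fps_X ^ k * fps_compose b \<psi> = fps_compose (fps_X ^ k * fps_compose b S) \<zeta>"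
proof -
  define H where "H = fps_X ^ k * fps_compose (lift_fps b) \<phi>"
  define a where "a = fps_X ^ k * fps_compose (lift_fps (fps_deriv b)) \<phi>"
  have \<phi>t: "time_deriv \<phi> = euler_op H" and \<phi>0: "at_time 0 \<phi> = S" and \<phi>z: "fps_nth \<phi> 0 = 0"
    using sol by (auto simp: burgers_solution_def H_def)
  have a0: "fps_nth a 0 = 0"
    using k by (simp add: a_def)
  obtain Z where Z: "time_deriv Z = a * euler_op Z" "at_time 0 Z = fps_X" "fps_nth Z 0 = 0" "fps_nth Z 1 = 1"
    using transport_exists[OF a0] by blast
  have Ht: "time_deriv H = a * euler_op H"
    by (simp add: H_def time_deriv_mult time_deriv_compose[OF \<phi>z] \<phi>t[unfolded H_def] a_def mult_ac)
  have HD: "euler_op H = of_nat k * H + a * euler_op \<phi>"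
    by (simp add: H_def a_def euler_op_mult euler_op_X_power euler_op_compose[OF \<phi>z] fps_deriv_lift_fps algebra_simps)
  \<comment> \<open>\<open>c\<close> is the polynomial \<open>k t\<close>, so \<open>Y\<close> is
    \<open>\<phi> - t k H\<close>. The term \<open>k H\<close> from differentiating \<open>c\<close>
    cancels the one in \<open>HD\<close>, which stems from the factor
    \<open>fps_X ^ k\<close>.\<close>
  define c :: "'a poly" where "c = [:0, of_nat k:]"
  define Y where "Y = \<phi> - fps_const c * H"
  have ct: "time_deriv (fps_const c) = of_nat k"
    by (rule fps_ext) (auto simp: c_def pderiv_pCons fps_of_nat[symmetric] of_nat_poly fps_const_def)
  have Yt: "time_deriv Y = a * euler_op Y"
    unfolding Y_def time_deriv_diff euler_op_diff time_deriv_mult euler_op_const_mult ct Ht \<phi>t HD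
    by (simp add: algebra_simps)
  have H0: "at_time 0 H = fps_X ^ k * fps_compose b S"
    by (simp add: H_def at_time_mult at_time_compose \<phi>0)
  have H1: "at_time 1 H = fps_X ^ k * fps_compose b \<psi>"
    by (simp add: H_def at_time_mult at_time_compose \<psi>_def)
  have Y0: "at_time 0 Y = S"
    by (rule fps_ext) (simp add: Y_def c_def \<phi>0[symmetric])
  have Y1: "at_time 1 Y = \<psi> - of_nat k * at_time 1 H"
    by (rule fps_ext) (simp add: Y_def c_def \<psi>_def fps_mult_of_nat_nth)
  note trans = transport_solution[OF a0 _ Z(1-3)]
  have "at_time 1 H = fps_compose (at_time 0 H) (at_time 1 Z)"
    by (subst trans[OF Ht]) (simp only: at_time_compose)
  moreover have "at_time 1 Y = fps_compose S (at_time 1 Z)"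
    by (subst trans[OF Yt]) (simp only: at_time_compose Y0)
  ultimately show thesis
    using Z(3,4) Y1 by (intro that[of "at_time 1 Z"]) (auto simp: H0 H1 algebra_simps)
qed

section \<open>From characteristics to the spectral curve\<close>

lemma cancelled_denominator_0: "cancelled_denominator 0 k S = 1"
proof -
  have "(fps_deriv ^^ n) 0 = (0 :: 'a fps)" for n
    by (induction n) auto
  then have "cancelled_denominator 0 k S = suminf (\<lambda>n. if n = 0 then 1 else 0)"
    unfolding cancelled_denominator_def by (intro arg_cong[of _ _ suminf] ext) auto
  also have "\<dots> = 1"
    by (subst suminf_finite[of "{0}"]) auto
  finally show ?thesis .
qed

text \<open>With \<open>f = fps_X * g\<close> the claim becomes \<open>g = 1\<close>. The cofactor
  of \<open>g - 1\<close> in \<open>g ^ k - 1\<close> has constant term \<open>k\<close>, which is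
  nonzero in characteristic zero, so it can be cancelled.\<close>

lemma fps_power_eq_X_power_imp:
  fixes f :: "'a::field_char_0 fps"
  assumes f: "f ^ k = fps_X ^ k" "fps_nth f 0 = 0" "fps_nth f 1 = 1" and k: "k \<ge> 1"
  shows "f = fps_X"
proof -
  define g where "g = fps_shift 1 f"
  have fg: "f = fps_X * g"
    using f(2) by (simp add: g_def fps_shift_times_fps_X' fps_eq_iff)
  have "fps_X ^ k * g ^ k = fps_X ^ k * 1"
    using f(1) by (simp add: fg power_mult_distrib)
  then have gk: "g ^ k = 1"
    by (subst (asm) mult_cancel_left) auto
  have g0: "fps_nth g 0 = 1"
    using f(3) by (simp add: g_def)
  have "(\<Sum>i<k. g ^ i) * (g - 1) = 0"
    using gk power_diff_1_eq[of g k] by (simp add: mult.commute)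
  moreover have "fps_nth (\<Sum>i<k. g ^ i) 0 \<noteq> 0"
    using k by (simp add: fps_sum_nth fps_nth_power_0 g0)
  ultimately have "g = 1" by auto
  then show ?thesis by (simp add: fg)
qed

lemma curve_X_0:
  assumes S: "fps_nth S 0 = 0" and k: "k \<ge> 1"
  shows "curve_X 0 k S = fps_X"
  using curve_X_power[OF S k, of 0] curve_X_nth_0[OF S k, of 0] curve_X_nth_1[OF S k, of 0] k
  by (intro fps_power_eq_X_power_imp) (simp_all add: cancelled_denominator_0)

text \<open>The two identities along the characteristics show that \<psi> is \<open>curve_y\<close>
  composed with \<zeta>. It remains to see that \<zeta> is the compositional inverse of
  \<open>curve_X\<close>, which follows by comparing \<open>k\<close>-th powers.\<close>

theorem burgers_spectral_curve:
  fixes b S :: "'a::field_char_0 fps"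
  assumes sol: "burgers_solution b k S \<phi>" and k: "k \<ge> 1"
    and S: "fps_nth S 0 = 0" and b: "fps_nth b 0 = 0"
  shows "fps_compose (at_time 1 \<phi>) (curve_X b k S) = curve_y b k S"
proof -
  define \<psi> where "\<psi> = at_time 1 \<phi>"
  define U where "U = cancelled_denominator b k S"
  define X where "X = curve_X b k S"
  obtain \<zeta> where \<zeta>: "fps_nth \<zeta> 0 = 0" "fps_nth \<zeta> 1 = 1"
    and \<psi>: "\<psi> = fps_compose S \<zeta> + of_nat k * (fps_X ^ k * fps_compose b \<psi>)"
    and H: "fps_X ^ k * fps_compose b \<psi> = fps_compose (fps_X ^ k * fps_compose b S) \<zeta>"
    using burgers_at_time_1[OF sol k] unfolding \<psi>_def by blast
  have X: "X ^ k * U = fps_X ^ k" "fps_nth X 0 = 0" "fps_nth X 1 = 1"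
    using curve_X_power[OF S k] curve_X_nth_0[OF S k] curve_X_nth_1[OF S k] by (simp_all add: X_def U_def)
  have \<psi>': "\<psi> = fps_compose (curve_y b k S) \<zeta>"
    by (subst \<psi>, subst H)
       (simp add: curve_y_def fps_compose_add_distrib fps_compose_mult_distrib[OF \<zeta>(1)] mult_ac)
  show ?thesis
  proof (cases "fps_compose b S = 0")
    \<comment> \<open>The general argument cancels \<open>b\<close> composed with \<open>S\<close>.
      When this vanishes, either \<open>S = 0\<close> and both sides are \<open>0\<close>, or
      \<open>b = 0\<close>, where \<phi> does not move and \<open>curve_X\<close> is
      \<open>fps_X\<close>.\<close>
    case True
    then have "\<psi> = fps_compose S \<zeta>" and y: "curve_y b k S = S"
      using \<psi>' by (simp_all add: curve_y_def)
    have "b = 0 \<or> S = 0"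
      using True S fps_compose_eq_0_iff[of S b] by auto
    then show ?thesis
    proof
      assume "S = 0"
      then show ?thesis using \<psi>' y by (simp add: \<psi>_def)
    next
      assume "b = 0"
      moreover have "lift_fps (0 :: 'a fps) = 0"
        by (rule fps_ext) simp
      ultimately have "time_deriv \<phi> = 0"
        using sol by (simp add: burgers_solution_def euler_op_def)
      then have "pderiv (fps_nth \<phi> n) = 0" for n
        by (metis fps_nth_fps_map fps_zero_nth)
      have "poly (fps_nth \<phi> n) 1 = poly (fps_nth \<phi> n) 0" for n
      proof -
        obtain c where "fps_nth \<phi> n = [:c:]"
          using \<open>pderiv (fps_nth \<phi> n) = 0\<close> by (metis degree_eq_zeroE pderiv_eq_0_iff)
        then show ?thesis by simp
      qed
      then have "at_time 1 \<phi> = at_time 0 \<phi>"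
        by (simp add: fps_eq_iff)
      then show ?thesis
        using sol \<open>b = 0\<close> y by (simp add: curve_X_0[OF S k] burgers_solution_def)
    qed
  next
    case False
    have y0: "fps_nth (curve_y b k S) 0 = 0"
      using S k by (simp add: curve_y_def)
    \<comment> \<open>Evaluating \<open>b\<close> at \<psi> through \<open>curve_y\<close> brings in
      the factor \<open>U\<close>. Comparison with \<open>H\<close> then gives
      \<open>\<zeta> ^ k = fps_X ^ k * fps_compose U \<zeta>\<close>, while the relation defining
      \<open>X\<close>, composed with \<zeta>, expresses the same \<open>\<zeta> ^ k\<close> through
      \<open>X\<close>.\<close>
    have "fps_X ^ k * fps_compose b \<psi> = fps_X ^ k * fps_compose (fps_compose b (curve_y b k S)) \<zeta>"
      unfolding \<psi>' by (simp add: fps_compose_assoc[OF \<zeta>(1) y0])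
    also have "\<dots> = fps_X ^ k * (fps_compose (fps_compose b S) \<zeta> * fps_compose U \<zeta>)"
      by (simp add: U_def cancelled_denominator_mult[OF S k, symmetric] fps_compose_mult_distrib[OF \<zeta>(1)])
    finally have "\<zeta> ^ k * fps_compose (fps_compose b S) \<zeta> = fps_X ^ k * fps_compose U \<zeta> * fps_compose (fps_compose b S) \<zeta>"
      using H \<zeta>(1) by (auto simp: fps_compose_mult_distrib[OF \<zeta>(1)] mult_ac simp flip: fps_compose_power[OF \<zeta>(1)])
    moreover have "\<zeta> \<noteq> 0" using \<zeta>(2) by auto
    then have "fps_compose (fps_compose b S) \<zeta> \<noteq> 0"
      using False \<zeta> fps_compose_eq_0_iff[of \<zeta> "fps_compose b S"] by auto
    ultimately have "\<zeta> ^ k = fps_X ^ k * fps_compose U \<zeta>"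
      by simp
    moreover have "fps_compose X \<zeta> ^ k * fps_compose U \<zeta> = \<zeta> ^ k"
      using arg_cong[OF X(1), of "\<lambda>f. fps_compose f \<zeta>"] \<zeta>(1)
      by (simp add: fps_compose_mult_distrib[OF \<zeta>(1)] flip: fps_compose_power[OF \<zeta>(1)])
    moreover have "fps_nth U 0 = 1"
      using cancelled_denominator_nth_0[OF S k] by (simp add: U_def)
    then have "fps_compose U \<zeta> \<noteq> 0"
      by (metis fps_compose_nth_0 fps_zero_nth zero_neq_one)
    ultimately have "fps_compose X \<zeta> ^ k = fps_X ^ k"
      by (metis mult_cancel_right)
    then have X\<zeta>: "fps_compose X \<zeta> = fps_X"
      using k X \<zeta> by (intro fps_power_eq_X_power_imp) (auto simp: fps_compose_nth)
    have inv: "fps_compose (fps_inv X) X = fps_X"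
      using X by (intro fps_inv) auto
    \<comment> \<open>So far \<zeta> inverts \<open>X\<close> from the right only. Associativity
      identifies it with the left inverse \<open>fps_inv X\<close>, which gives the composition in
      the other order.\<close>
    have "\<zeta> = fps_compose (fps_compose (fps_inv X) X) \<zeta>"
      using \<zeta>(1) by (simp add: inv)
    also have "\<dots> = fps_inv X"
      using X \<zeta> by (subst fps_compose_assoc[symmetric]) (auto simp: X\<zeta>)
    finally have "fps_compose \<zeta> X = fps_X"
      using inv by simp
    then have "fps_compose \<psi> X = curve_y b k S"
      using \<psi>' X \<zeta> by (simp add: fps_compose_assoc[symmetric])
    then show ?thesis by (simp add: \<psi>_def X_def)
  qed
qed

section \<open>Coherent states\<close>

lemma J_neg: "0 < j \<Longrightarrow> J (- int j) f \<mu> = (if j \<in># \<mu> then f (\<mu> - {#j#}) else 0)"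
  by (simp add: J_def)

lemma J_pos: "J (int j) f \<mu> = of_nat j * of_nat (Suc (count \<mu> j)) * f (add_mset j \<mu>)"
  by (simp add: J_def)

text \<open>The Heisenberg relation: for \<open>i = j\<close> the two orders give
  \<open>i * (count \<mu> i + 1)\<close> and \<open>i * count \<mu> i\<close> times
  \<open>f \<mu>\<close>.\<close>

lemma J_commute:
  assumes "0 < i" "0 < j"
  shows "J (int i) (J (- int j) f) \<mu> = J (- int j) (J (int i) f) \<mu> + (if i = j then of_nat i * f \<mu> else 0)"
proof (cases "i = j")
  case True
  have "count \<mu> j = Suc (count (\<mu> - {#j#}) j)" if "j \<in># \<mu>"
    using that by (simp add: Suc_diff_1)
  then show ?thesis
    using True assms by (auto simp: J_neg J_pos algebra_simps not_in_iff)
next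
  case False
  then show ?thesis
    using assms by (cases "j \<in># \<mu>") (simp_all add: J_neg J_pos)
qed

lemma foldr_J_map:
  assumes "T 0 = 0" "\<And>(i::int) (n::nat) x. T (of_int i * of_nat n * x) = of_int i * of_nat n * T x"
  shows "foldr J js (\<lambda>\<mu>. T (f \<mu>)) = (\<lambda>\<mu>. T (foldr J js f \<mu>))"
proof (induction js)
  case (Cons j js)
  have "J j (\<lambda>\<mu>. T (g \<mu>)) = (\<lambda>\<mu>. T (J j g \<mu>))" for g
    by (rule ext) (simp add: J_def assms del: of_nat_Suc)
  then show ?case
    using Cons by simp
qed simp

section \<open>Compositions and coefficients of powers\<close>

definition positive_lists :: "nat \<Rightarrow> int \<Rightarrow> int list set" where
  "positive_lists r n = {js. length js = r \<and> (\<forall>j\<in>set js. 0 < j) \<and> sum_list js = n}"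

lemma positive_lists_0: "positive_lists 0 n = (if n = 0 then {[]} else {})"
  by (auto simp: positive_lists_def)

lemma positive_list_bounds:
  assumes "\<forall>j\<in>set js. (0::int) < j"
  shows "int (length js) \<le> sum_list js" "\<forall>j\<in>set js. j \<le> sum_list js"
proof -
  have "int (length js) \<le> sum_list js \<and> (\<forall>j\<in>set js. j \<le> sum_list js)"
    using assms by (induction js) fastforce+
  then show "int (length js) \<le> sum_list js" "\<forall>j\<in>set js. j \<le> sum_list js"
    by auto
qed

lemma positive_lists_Suc:
  "positive_lists (Suc r) n = (\<Union>i\<in>{1..n}. (#) i ` positive_lists r (n - i))"
proof (intro equalityI subsetI)
  fix js assume js: "js \<in> positive_lists (Suc r) n"
  then obtain i js' where js': "js = i # js'"
    by (cases js) (auto simp: positive_lists_def)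
  with js have "i \<in> {1..n}" "js' \<in> positive_lists r (n - i)"
    using positive_list_bounds(2)[of js] by (auto simp: positive_lists_def)
  with js' show "js \<in> (\<Union>i\<in>{1..n}. (#) i ` positive_lists r (n - i))"
    by blast
qed (auto simp: positive_lists_def)

lemma finite_positive_lists [simp]: "finite (positive_lists r n)"
  by (induction r arbitrary: n) (auto simp: positive_lists_0 positive_lists_Suc)

lemma positive_lists_empty: "n < int r \<Longrightarrow> positive_lists r n = {}"
  using positive_list_bounds(1) by (fastforce simp: positive_lists_def)

text \<open>Splitting off the first part of a composition mirrors multiplication by one factor
  \<phi>; parts equal to \<open>0\<close> are absent because \<phi> has no constant term.\<close>

lemma fps_power_nth_positive_lists:
  fixes \<phi> :: "'b::comm_ring_1 fps"
  assumes \<phi>: "fps_nth \<phi> 0 = 0"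
  shows "(\<Sum>js\<in>positive_lists r (int n). \<Prod>j\<leftarrow>js. fps_nth \<phi> (nat j)) = fps_nth (\<phi> ^ r) n"
proof (induction r arbitrary: n)
  case 0
  then show ?case by (simp add: positive_lists_0)
next
  case (Suc r)
  have "(\<Sum>js\<in>positive_lists (Suc r) (int n). \<Prod>j\<leftarrow>js. fps_nth \<phi> (nat j))
      = (\<Sum>i\<in>{1..int n}. \<Sum>js\<in>(#) i ` positive_lists r (int n - i). \<Prod>j\<leftarrow>js. fps_nth \<phi> (nat j))"
    unfolding positive_lists_Suc by (rule sum.UNION_disjoint) auto
  also have "\<dots> = (\<Sum>i\<in>{1..int n}. fps_nth \<phi> (nat i) * (\<Sum>js\<in>positive_lists r (int n - i). \<Prod>j\<leftarrow>js. fps_nth \<phi> (nat j)))"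
    by (intro sum.cong refl) (simp add: sum.reindex sum_distrib_left)
  also have "\<dots> = (\<Sum>i\<in>{1..n}. fps_nth \<phi> i * fps_nth (\<phi> ^ r) (n - i))"
    by (rule sum.reindex_bij_witness[of _ int nat]) (auto simp: Suc[symmetric] of_nat_diff)
  also have "\<dots> = fps_nth (\<phi> ^ Suc r) n"
    unfolding power_Suc fps_mult_nth using \<phi> by (intro sum.mono_neutral_left) (auto simp: Suc_le_eq)
  finally show ?case .
qed

text \<open>The operator \<open>\<Sum>\<^sub>j p\<^sub>j [z\<^bsup>j-k\<^esup>] b(\<Sum>\<^sub>i J\<^sub>i z\<^sup>i)\<close>, of first order in the \<open>p\<^sub>j\<close>.\<close>

definition leading_op :: "'c::comm_ring_1 fps \<Rightarrow> nat \<Rightarrow> 'c fock \<Rightarrow> 'c fock" where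
  "leading_op b k h \<mu> =
     (\<Sum>j\<in>set_mset \<mu>. \<Sum>r\<le>sum_mset \<mu>. fps_nth b r *
        (\<Sum>js\<in>positive_lists r (int j - int k). foldr J js h (\<mu> - {#j#})))"

lemma member_le_sum_mset: "j \<in># \<mu> \<Longrightarrow> j \<le> sum_mset (\<mu> :: nat multiset)"
  by (metis insert_DiffM le_add1 sum_mset.add_mset)

text \<open>Used with \<open>T\<close> the extraction of a coefficient in time, where
  \<open>b\<close> has constant polynomials as coefficients, and with \<open>T\<close> the division
  by a factorial.\<close>

lemma leading_op_map:
  assumes "\<And>x y. T (x + y) = T x + T y"
    and "\<And>(i::int) (n::nat) x. T (of_int i * of_nat n * x) = of_int i * of_nat n * T x"
    and "\<And>r x. T (fps_nth b r * x) = fps_nth b' r * T x"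
  shows "leading_op b' k (\<lambda>\<mu>. T (h \<mu>)) \<mu> = T (leading_op b k h \<mu>)"
proof -
  have T0: "T 0 = 0"
    using assms(1)[of 0 0] by simp
  have Tsum: "T (sum f A) = (\<Sum>x\<in>A. T (f x))" for f :: "'x \<Rightarrow> _" and A
    by (induction A rule: infinite_finite_induct) (simp_all add: T0 assms(1))
  show ?thesis
    unfolding leading_op_def foldr_J_map[OF T0 assms(2)] by (simp add: Tsum assms(3) flip: sum_distrib_left)
qed

section \<open>Coherent states as eigenvectors and their evolution\<close>

text \<open>The classical number \<open>z\<^sub>\<mu>\<close>. It is \<open>0\<close> if \<mu>
  contains \<open>0\<close>, and dividing by it then gives \<open>0\<close>, so coherent states
  vanish on such multisets.\<close>

definition sym_factor :: "nat multiset \<Rightarrow> 'a::field_char_0" where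
  "sym_factor \<mu> = (\<Prod>i\<in>#\<mu>. of_nat i) * (\<Prod>i\<in>set_mset \<mu>. fact (count \<mu> i))"

lemma sym_factor_add_mset:
  "sym_factor (add_mset i \<mu>) = of_nat i * of_nat (Suc (count \<mu> i)) * (sym_factor \<mu> :: 'a::field_char_0)"
proof -
  have "(\<Prod>j\<in>set_mset (add_mset i \<mu>). fact (count (add_mset i \<mu>) j) :: 'a)
      = fact (Suc (count \<mu> i)) * (\<Prod>j\<in>set_mset \<mu> - {i}. fact (count \<mu> j))"
    by (simp add: prod.insert_remove)
  also have "\<dots> = of_nat (Suc (count \<mu> i)) * (\<Prod>j\<in>set_mset \<mu>. fact (count \<mu> j))"
    by (cases "i \<in># \<mu>") (simp_all add: prod.remove not_in_iff del: of_nat_Suc)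
  finally show ?thesis
    by (simp add: sym_factor_def del: of_nat_Suc)
qed

text \<open>The coefficients of \<open>exp (\<Sum>\<^sub>i \<phi>\<^sub>i p\<^sub>i / i)\<close>.\<close>

definition coherent :: "'a::field_char_0 fps \<Rightarrow> 'a fock" where
  "coherent \<phi> \<mu> = (\<Prod>i\<in>#\<mu>. fps_nth \<phi> i) / sym_factor \<mu>"

definition coherent_poly :: "'a::field_char_0 poly fps \<Rightarrow> 'a poly fock" where
  "coherent_poly \<phi> \<mu> = smult (1 / sym_factor \<mu>) (\<Prod>i\<in>#\<mu>. fps_nth \<phi> i)"

lemma poly_coherent_poly: "poly (coherent_poly \<phi> \<mu>) t = coherent (at_time t \<phi>) \<mu>"
proof -
  have "poly (\<Prod>i\<in>#\<mu>. fps_nth \<phi> i) t = (\<Prod>i\<in>#\<mu>. poly (fps_nth \<phi> i) t)"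
    by (induction \<mu>) simp_all
  then show ?thesis
    by (simp add: coherent_poly_def coherent_def)
qed

lemma coherent_poly_containing_0: "0 \<in># \<mu> \<Longrightarrow> coherent_poly \<phi> \<mu> = 0"
  by (auto simp: coherent_poly_def sym_factor_def)

lemma coherent_containing_0: "0 \<in># \<mu> \<Longrightarrow> coherent \<phi> \<mu> = 0"
  by (auto simp: coherent_def sym_factor_def)

lemma coherent_add_mset:
  assumes "0 < i"
  shows "of_nat (Suc (count \<mu> i)) * coherent \<phi> (add_mset i \<mu>) = fps_nth \<phi> i / of_nat i * coherent \<phi> \<mu>"
  using assms by (simp add: coherent_def sym_factor_add_mset del: of_nat_Suc)

text \<open>The scalar produced by \<open>J\<close> is exactly the ratio of symmetry factors in
  \<open>sym_factor_add_mset\<close>, so coherent states are joint eigenvectors of the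
  derivations.\<close>

lemma J_coherent_poly:
  assumes "0 < i"
  shows "J (int i) (coherent_poly \<phi>) = (\<lambda>\<mu>. fps_nth \<phi> i * coherent_poly \<phi> \<mu>)"
proof
  fix \<mu>
  have "of_nat i * of_nat (Suc (count \<mu> i)) = [:of_nat i * of_nat (Suc (count \<mu> i)) :: 'a:]"
    by (simp add: of_nat_poly del: of_nat_Suc)
  then show "J (int i) (coherent_poly \<phi>) \<mu> = fps_nth \<phi> i * coherent_poly \<phi> \<mu>"
    using assms by (simp add: J_pos coherent_poly_def sym_factor_add_mset del: of_nat_Suc)
qed

lemma foldr_J_coherent_poly:
  assumes "\<forall>j\<in>set js. 0 < j"
  shows "foldr J js (coherent_poly \<phi>) = (\<lambda>\<mu>. (\<Prod>j\<leftarrow>js. fps_nth \<phi> (nat j)) * coherent_poly \<phi> \<mu>)"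
  using assms
proof (induction js)
  case (Cons j js)
  let ?c = "\<Prod>j\<leftarrow>js. fps_nth \<phi> (nat j)"
  have "foldr J (j # js) (coherent_poly \<phi>) = J j (\<lambda>\<mu>. ?c * coherent_poly \<phi> \<mu>)"
    using Cons by simp
  also have "\<dots> = (\<lambda>\<mu>. ?c * J j (coherent_poly \<phi>) \<mu>)"
    by (rule ext) (simp add: J_def)
  also have "J j (coherent_poly \<phi>) = (\<lambda>\<mu>. fps_nth \<phi> (nat j) * coherent_poly \<phi> \<mu>)"
    using J_coherent_poly[of "nat j" \<phi>] Cons.prems by simp
  finally show ?case
    by (simp add: mult_ac)
qed simp

text \<open>All derivations become eigenvalues; the sum over compositions collapses to a coefficient
  of \<open>\<phi> ^ r\<close>, and the sum over \<open>r\<close> to the composition with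
  \<open>b\<close>.\<close>

lemma leading_op_coherent_poly:
  assumes \<phi>: "fps_nth \<phi> 0 = 0"
  shows "leading_op b k (coherent_poly \<phi>) \<mu> =
    (\<Sum>j\<in>set_mset \<mu>. fps_nth (fps_X ^ k * fps_compose b \<phi>) j * coherent_poly \<phi> (\<mu> - {#j#}))"
  unfolding leading_op_def
proof (intro sum.cong refl)
  fix j assume "j \<in># \<mu>"
  then have j: "j \<le> sum_mset \<mu>" by (rule member_le_sum_mset)
  have "(\<Sum>js\<in>positive_lists r (int j - int k). foldr J js (coherent_poly \<phi>) (\<mu> - {#j#}))
      = (if j < k then 0 else fps_nth (\<phi> ^ r) (j - k)) * coherent_poly \<phi> (\<mu> - {#j#})" for r
  proof (cases "j < k")
    case True
    then show ?thesis by (simp add: positive_lists_empty)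
  next
    case False
    have "(\<Sum>js\<in>positive_lists r (int j - int k). foldr J js (coherent_poly \<phi>) (\<mu> - {#j#}))
        = (\<Sum>js\<in>positive_lists r (int (j - k)). (\<Prod>j\<leftarrow>js. fps_nth \<phi> (nat j)) * coherent_poly \<phi> (\<mu> - {#j#}))"
      using False by (intro sum.cong) (auto simp: foldr_J_coherent_poly positive_lists_def of_nat_diff)
    then show ?thesis
      using False fps_power_nth_positive_lists[OF \<phi>, of r "j - k"]
      by (simp add: of_nat_diff flip: sum_distrib_right)
  qed
  moreover have "(\<Sum>r\<le>sum_mset \<mu>. fps_nth b r * (if j < k then 0 else fps_nth (\<phi> ^ r) (j - k)))
      = fps_nth (fps_X ^ k * fps_compose b \<phi>) j"
  proof (cases "j < k")
    case False
    have "(\<Sum>r\<le>sum_mset \<mu>. fps_nth b r * fps_nth (\<phi> ^ r) (j - k)) = fps_nth (fps_compose b \<phi>) (j - k)"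
      unfolding fps_compose_nth
      using j startsby_zero_power_prefix[OF \<phi>] by (intro sum.mono_neutral_right) auto
    then show ?thesis using False by (simp add: fps_X_power_mult_nth)
  qed (simp add: fps_X_power_mult_nth)
  ultimately show "(\<Sum>r\<le>sum_mset \<mu>. fps_nth b r *
        (\<Sum>js\<in>positive_lists r (int j - int k). foldr J js (coherent_poly \<phi>) (\<mu> - {#j#})))
      = fps_nth (fps_X ^ k * fps_compose b \<phi>) j * coherent_poly \<phi> (\<mu> - {#j#})"
    by (simp add: mult.assoc[symmetric] flip: sum_distrib_right)
qed

text \<open>This is the derivative of the exponential, proved by adding one part at a time to \<mu>.
  The range \<open>{1..M}\<close> is independent of \<mu> so that the same sum occurs on both sides
  of the induction.\<close>

lemma pderiv_coherent_poly_aux: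
  assumes d: "\<And>j. pderiv (fps_nth \<phi> j) = of_nat j * d j"
    and M: "set_mset \<mu> \<subseteq> {1..M}"
  shows "pderiv (coherent_poly \<phi> \<mu>) = (\<Sum>j=1..M. d j * J (- int j) (coherent_poly \<phi>) \<mu>)"
  using M
proof (induction \<mu>)
  case empty
  then show ?case
    by (simp add: coherent_poly_def pderiv_smult pderiv_1 J_neg)
next
  case (add i \<mu>)
  let ?G = "coherent_poly \<phi>"
  let ?c = "of_nat i * of_nat (Suc (count \<mu> i)) :: 'a poly"
  let ?R = "\<lambda>\<mu>. \<Sum>j=1..M. d j * J (- int j) ?G \<mu>"
  have i: "0 < i" "i \<in> {1..M}" using add.prems by auto
  have c: "?c = [:of_nat i * of_nat (Suc (count \<mu> i)):]"
    by (simp add: of_nat_poly del: of_nat_Suc)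
  have cG: "?c * ?G (add_mset i \<mu>) = fps_nth \<phi> i * ?G \<mu>"
    using J_coherent_poly[OF i(1), of \<phi>] by (simp add: J_pos fun_eq_iff del: of_nat_Suc)
  \<comment> \<open>Multiplying by \<open>?c\<close> amounts to applying \<open>J (int i)\<close>.
    The term from differentiating the eigenvalue \<open>fps_nth \<phi> i\<close> is the commutator
    term of \<open>J_commute\<close>.\<close>
  have "?c * pderiv (?G (add_mset i \<mu>)) = pderiv (fps_nth \<phi> i * ?G \<mu>)"
    unfolding cG[symmetric] c by (simp add: pderiv_smult)
  also have "\<dots> = fps_nth \<phi> i * ?R \<mu> + of_nat i * d i * ?G \<mu>"
    using add by (simp add: pderiv_mult d mult_ac)
  also have "\<dots> = (\<Sum>j=1..M. d j * (J (- int j) (J (int i) ?G) \<mu> + (if i = j then of_nat i * ?G \<mu> else 0)))"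
  proof -
    have "(\<Sum>j=1..M. d j * (if i = j then of_nat i * ?G \<mu> else 0)) = of_nat i * d i * ?G \<mu>"
      using i(2) by (subst sum.remove[of _ i]) (auto simp: mult_ac)
    moreover have "J (- int j) (J (int i) ?G) \<mu> = fps_nth \<phi> i * J (- int j) ?G \<mu>" if "j \<in> {1..M}" for j
      using that i by (simp add: J_coherent_poly J_neg)
    ultimately show ?thesis
      by (simp add: ring_distribs sum.distrib sum_distrib_left mult_ac)
  qed
  also have "\<dots> = (\<Sum>j=1..M. d j * J (int i) (J (- int j) ?G) \<mu>)"
    using i by (intro sum.cong refl arg_cong2[of _ _ _ _ "(*)"] J_commute[symmetric]) auto
  also have "\<dots> = ?c * ?R (add_mset i \<mu>)"
    unfolding J_pos sum_distrib_left by (simp add: mult_ac del: of_nat_Suc)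
  finally have "?c * pderiv (?G (add_mset i \<mu>)) = ?c * ?R (add_mset i \<mu>)" .
  moreover have "?c \<noteq> 0"
    unfolding c using i by (simp del: of_nat_Suc)
  ultimately show ?case
    by (simp only: mult_cancel_left) blast
qed

lemma pderiv_coherent_poly:
  assumes d: "\<And>j. pderiv (fps_nth \<phi> j) = of_nat j * d j" and d0: "d 0 = 0"
  shows "pderiv (coherent_poly \<phi> \<mu>) = (\<Sum>j\<in>set_mset \<mu>. d j * coherent_poly \<phi> (\<mu> - {#j#}))"
proof (cases "0 \<in># \<mu>")
  case True
  have "d j * coherent_poly \<phi> (\<mu> - {#j#}) = 0" for j
  proof (cases "j = 0")
    case False
    then have "0 \<in># \<mu> - {#j#}" using True by (simp add: in_diff_count)
    then have "coherent_poly \<phi> (\<mu> - {#j#}) = 0" by (rule coherent_poly_containing_0)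
    then show ?thesis by simp
  qed (simp add: d0)
  then have "(\<Sum>j\<in>set_mset \<mu>. d j * coherent_poly \<phi> (\<mu> - {#j#})) = 0"
    by (intro sum.neutral ballI)
  moreover have "coherent_poly \<phi> \<mu> = 0"
    using True by (rule coherent_poly_containing_0)
  ultimately show ?thesis by simp
next
  case False
  have \<mu>: "set_mset \<mu> \<subseteq> {1..sum_mset \<mu>}"
  proof
    fix j assume "j \<in># \<mu>"
    then show "j \<in> {1..sum_mset \<mu>}"
      using False member_le_sum_mset[of j \<mu>] by (cases "j = 0") auto
  qed
  have "pderiv (coherent_poly \<phi> \<mu>) = (\<Sum>j=1..sum_mset \<mu>. d j * J (- int j) (coherent_poly \<phi>) \<mu>)"
    by (rule pderiv_coherent_poly_aux[OF d \<mu>])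
  also have "\<dots> = (\<Sum>j\<in>set_mset \<mu>. d j * coherent_poly \<phi> (\<mu> - {#j#}))"
    using \<mu> False by (intro sum.mono_neutral_cong_right) (auto simp: J_neg)
  finally show ?thesis .
qed

text \<open>The time derivative of the coherent state is \<open>leading_op\<close> applied to it, so
  its Taylor coefficients in time satisfy the recursion of the exponential of
  \<open>t * leading_op\<close>. Working coefficientwise needs no convergence of that
  exponential.\<close>

theorem coeff_coherent_poly_burgers:
  assumes sol: "burgers_solution b k S \<phi>" and k: "k \<ge> 1"
  shows "coeff (coherent_poly \<phi> \<mu>) n = (leading_op b k ^^ n) (coherent S) \<mu> / fact n"
proof (induction n arbitrary: \<mu>)
  case 0
  have "coeff (coherent_poly \<phi> \<mu>) 0 = poly (coherent_poly \<phi> \<mu>) 0"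
    by (simp add: poly_0_coeff_0)
  then show ?case
    using sol by (simp add: poly_coherent_poly burgers_solution_def)
next
  case (Suc n)
  define H where "H = fps_X ^ k * fps_compose (lift_fps b) \<phi>"
  have \<phi>0: "fps_nth \<phi> 0 = 0" and \<phi>t: "time_deriv \<phi> = euler_op H"
    using sol by (auto simp: burgers_solution_def H_def)
  have "pderiv (fps_nth \<phi> j) = of_nat j * fps_nth H j" for j
    using arg_cong[OF \<phi>t, of "\<lambda>f. fps_nth f j"] by simp
  then have "pderiv (coherent_poly \<phi> \<mu>) = leading_op (lift_fps b) k (coherent_poly \<phi>) \<mu>"
    using k by (subst pderiv_coherent_poly[where d = "fps_nth H"])
      (simp_all add: leading_op_coherent_poly[OF \<phi>0] H_def)
  then have "of_nat (Suc n) * coeff (coherent_poly \<phi> \<mu>) (Suc n) = coeff (leading_op (lift_fps b) k (coherent_poly \<phi>) \<mu>) n"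
    by (metis coeff_pderiv)
  also have "\<dots> = leading_op b k (\<lambda>\<mu>. coeff (coherent_poly \<phi> \<mu>) n) \<mu>"
    by (rule leading_op_map[symmetric]) (simp_all add: of_nat_poly of_int_poly)
  also have "\<dots> = leading_op b k (\<lambda>\<mu>. (leading_op b k ^^ n) (coherent S) \<mu> / fact n) \<mu>"
    by (simp only: Suc)
  also have "\<dots> = (leading_op b k ^^ Suc n) (coherent S) \<mu> / fact n"
    by (subst leading_op_map[where T = "\<lambda>x. x / fact n"]) (simp_all add: add_divide_distrib)
  finally show ?case
    by (simp add: divide_simps mult_ac del: of_nat_Suc)
qed

section \<open>The cut-and-join operator to leading order\<close>

text \<open>The order of \<open>g r\<close> is at least \<open>r - C\<close>, so only finitely many
  terms reach a given exponent, and the coefficientwise sum is the adic limit.\<close>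

lemma fls_suminf_nth:
  fixes g :: "nat \<Rightarrow> 'c::ab_group_add fls"
  assumes g: "\<And>r n. n < int r - int C \<Longrightarrow> fls_nth (g r) n = 0" and R: "n + int C < int R"
  shows "fls_nth (suminf g) n = (\<Sum>r<R. fls_nth (g r) n)"
proof -
  define F where "F = Abs_fls (\<lambda>n. \<Sum>r<nat (n + int C + 1). fls_nth (g r) n)"
  have F: "fls_nth F n = (\<Sum>r<nat (n + int C + 1). fls_nth (g r) n)" for n
    unfolding F_def by (rule nth_Abs_fls_lower_bound[of "- int C"]) auto
  have eq: "(\<Sum>r<N. fls_nth (g r) n) = fls_nth F n" if "n + int C < int N" for N n
    unfolding F using that g by (intro sum.mono_neutral_right) auto
  have "g sums F"
    unfolding sums_def
  proof (rule metric_LIMSEQ_I)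
    fix e :: real assume "0 < e"
    then obtain m where m: "(1/2) ^ m < e"
      using real_arch_pow_inv[of e "1/2"] by auto
    have "dist (sum g {..<N}) F < e" if "N \<ge> m + C" for N
    proof (cases "sum g {..<N} = F")
      case False
      have "int m \<le> fls_subdegree (sum g {..<N} - F)"
      proof (rule fls_subdegree_geI)
        show "fls_nth (sum g {..<N} - F) i = 0" if "i < int m" for i
          using that \<open>N \<ge> m + C\<close> by (simp add: fls_nth_sum eq)
      qed (use False in simp)
      then have "dist (sum g {..<N}) F \<le> (1/2) ^ m"
        using False by (auto simp: dist_fls_def power_one_over inverse_eq_divide intro!: divide_left_mono power_increasing)
      then show ?thesis using m by linarith
    qed (use \<open>0 < e\<close> in simp)
    then show "\<exists>no. \<forall>n\<ge>no. dist (sum g {..<n}) F < e"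
      by blast
  qed
  then have "fls_nth (suminf g) n = fls_nth F n"
    by (simp add: sums_iff)
  then show ?thesis
    using eq[OF R] by simp
qed

text \<open>Here \<open>m\<close> and \<open>l\<close> are only lower bounds for the orders. If one
  of them is not attained, both sides of the second claim are \<open>0\<close>.\<close>

lemma fls_mult_nth_bounds:
  fixes f g :: "'c::{comm_semiring_0,mult_zero} fls"
  assumes f: "\<And>i. i < m \<Longrightarrow> fls_nth f i = 0" and g: "\<And>i. i < l \<Longrightarrow> fls_nth g i = 0"
  shows "n < m + l \<Longrightarrow> fls_nth (f * g) n = 0"
    and "fls_nth (f * g) (m + l) = fls_nth f m * fls_nth g l"
proof -
  have "(n < m + l \<longrightarrow> fls_nth (f * g) n = 0) \<and> fls_nth (f * g) (m + l) = fls_nth f m * fls_nth g l"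
  proof (cases "f = 0 \<or> g = 0")
    case False
    then have deg: "m \<le> fls_subdegree f" "l \<le> fls_subdegree g"
      using f g by (auto intro: fls_subdegree_geI)
    have "fls_nth (f * g) (m + l) = fls_nth f m * fls_nth g l"
    proof (cases "fls_subdegree f = m \<and> fls_subdegree g = l")
      case True
      then show ?thesis using fls_times_base[of f g] by simp
    next
      case neq: False
      then have "m + l < fls_subdegree f + fls_subdegree g"
        using deg by linarith
      moreover have "m < fls_subdegree f \<or> l < fls_subdegree g"
        using neq deg by linarith
      ultimately show ?thesis
        by (auto simp: fls_times_nth_eq0)
    qed
    then show ?thesis
      using deg by (auto intro: fls_times_nth_eq0)
  qed auto
  then show "n < m + l \<Longrightarrow> fls_nth (f * g) n = 0"
    and "fls_nth (f * g) (m + l) = fls_nth f m * fls_nth g l" by auto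
qed

text \<open>
  Every \<open>p\<^sub>j\<close> is given weight \<open>\<hbar>\<close>: \<open>hcoeff d f\<close> collects the terms of weight \<open>d\<close> of \<open>f\<close>. In these
  weights the summand of \<open>W\<close> with \<open>a\<close> multiplications and \<open>b\<close> derivations has weight at least
  \<open>2 a - 2\<close>, so to leading order only the terms with \<open>a = 1\<close> survive.
\<close>

definition hcoeff :: "int \<Rightarrow> 'a::zero fls fock \<Rightarrow> 'a fock" where
  "hcoeff d f \<mu> = fls_nth (f \<mu>) (d - int (size \<mu>))"

text \<open>Derivations minus multiplications: the amount by which the product of the
  \<open>J\<close> lowers the \<hbar>-weight.\<close>

definition wt :: "int list \<Rightarrow> int" where
  "wt js = sum_list (map sgn js)"

lemma hcoeff_J:
  fixes f :: "'a::field_char_0 fls fock"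
  assumes "j \<noteq> 0"
  shows "hcoeff (d - sgn j) (J j f) = J j (hcoeff d f)"
proof (rule ext)
  fix \<mu>
  show "hcoeff (d - sgn j) (J j f) \<mu> = J j (hcoeff d f) \<mu>"
  proof (cases "j < 0")
    case True
    have "size \<mu> = Suc (size (\<mu> - {#nat (- j)#}))" if "nat (- j) \<in># \<mu>"
      using that by (metis insert_DiffM size_add_mset)
    then show ?thesis
      using True by (auto simp: hcoeff_def J_def algebra_simps)
  next
    case False
    then show ?thesis
      using assms
      by (simp add: hcoeff_def J_def fls_of_int fls_of_nat mult.assoc algebra_simps of_nat_Suc[where 'a = int] del: of_nat_Suc)
  qed
qed

lemma hcoeff_foldr_J:
  fixes f :: "'a::field_char_0 fls fock"
  assumes "0 \<notin> set js"
  shows "hcoeff (d - wt js) (foldr J js f) = foldr J js (hcoeff d f)"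
  using assms
proof (induction js)
  case (Cons j js)
  have "hcoeff (d - wt (j # js)) (foldr J (j # js) f) = hcoeff ((d - wt js) - sgn j) (J j (foldr J js f))"
    by (simp add: wt_def algebra_simps)
  also have "\<dots> = J j (hcoeff (d - wt js) (foldr J js f))"
    using Cons.prems by (intro hcoeff_J) auto
  finally show ?case
    using Cons by simp
qed (simp add: wt_def)

lemma sum_list_map_normal_order:
  fixes h :: "int \<Rightarrow> int"
  assumes "0 \<notin> set js"
  shows "sum_list (map h (filter (\<lambda>j. j < 0) js @ filter (\<lambda>j. 0 < j) js)) = sum_list (map h js)"
  using assms by (induction js) auto

lemma hcoeff_normal_ordered:
  fixes f :: "'a::field_char_0 fls fock"
  assumes "0 \<notin> set js"
  shows "hcoeff d (normal_ordered js f) = normal_ordered js (hcoeff (d + wt js) f)"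
proof -
  let ?js = "filter (\<lambda>j. j < 0) js @ filter (\<lambda>j. 0 < j) js"
  have "wt ?js = wt js"
    using sum_list_map_normal_order[OF assms, of sgn] by (simp add: wt_def)
  then show ?thesis
    using hcoeff_foldr_J[of ?js "d + wt js" f] by (simp add: normal_ordered_def)
qed

section \<open>Finiteness of the contributing tuples\<close>

lemma foldr_J_zero: "foldr J js (\<lambda>_. 0) = (\<lambda>_. 0)"
  by (induction js) (simp_all add: J_def fun_eq_iff)

lemma normal_ordered_zero: "normal_ordered js (\<lambda>_. 0) = (\<lambda>_. 0)"
  by (simp only: normal_ordered_def foldr_J_zero)

lemma foldr_J_neg_support:
  assumes "\<forall>j\<in>set js. j < 0" "foldr J js f \<mu> \<noteq> 0"
  shows "mset (map (\<lambda>j. nat (- j)) js) \<subseteq># \<mu>"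
  using assms
proof (induction js arbitrary: \<mu>)
  case (Cons j js)
  have "J j (foldr J js f) \<mu> \<noteq> 0"
    using Cons.prems by simp
  then have j: "nat (- j) \<in># \<mu>" and nz: "foldr J js f (\<mu> - {#nat (- j)#}) \<noteq> 0"
    using Cons.prems(1) by (auto simp: J_def[of j "foldr J js f" \<mu>] split: if_splits)
  have "mset (map (\<lambda>j. nat (- j)) js) \<subseteq># \<mu> - {#nat (- j)#}"
    using Cons nz by auto
  with j show ?case
    by (simp add: insert_subset_eq_iff)
qed simp

definition relevant_lists :: "nat \<Rightarrow> nat multiset \<Rightarrow> int list set" where
  "relevant_lists k \<mu> = {js. 0 \<notin> set js \<and> sum_list js = - int k \<and>
     set js \<subseteq> {- int (sum_mset \<mu>)..int (sum_mset \<mu>)} \<and> length js \<le> 2 * sum_mset \<mu>}"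

lemma finite_relevant_lists [simp]: "finite (relevant_lists k \<mu>)"
  by (rule finite_subset[OF _ finite_lists_length_le[of "{- int (sum_mset \<mu>)..int (sum_mset \<mu>)}" "2 * sum_mset \<mu>"]])
     (auto simp: relevant_lists_def)

text \<open>The multiplications act last, so the negative entries are bounded by the total of \<mu>.
  As the overall sum is \<open>- int k\<close>, the positive entries obey the same bound; both kinds
  together account for the length bound \<open>2 * sum_mset \<mu>\<close>.\<close>

lemma normal_ordered_support:
  assumes nz: "normal_ordered js f \<mu> \<noteq> 0" and js: "0 \<notin> set js" "sum_list js = - int k"
  shows "js \<in> relevant_lists k \<mu>"
proof -
  define ns where "ns = filter (\<lambda>j. j < 0) js"
  define ps where "ps = filter (\<lambda>j. 0 < j) js"
  let ?M = "sum_mset \<mu>"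
  have split: "sum_list (map h js) = sum_list (map h ns) + sum_list (map h ps)" for h :: "int \<Rightarrow> int"
    using sum_list_map_normal_order[OF js(1), of h] by (simp add: ns_def ps_def)
  have "mset (map (\<lambda>j. nat (- j)) ns) \<subseteq># \<mu>"
    using nz by (intro foldr_J_neg_support[of _ "foldr J ps f"]) (auto simp: normal_ordered_def ns_def ps_def)
  then have "sum_list (map (\<lambda>j. nat (- j)) ns) \<le> ?M"
    by (metis le_add1 subset_mset.add_diff_inverse sum_mset.union sum_mset_sum_list)
  moreover have "int (sum_list (map (\<lambda>j. nat (- j)) xs)) = sum_list (map uminus xs)" if "\<forall>j\<in>set xs. j < 0" for xs
    using that by (induction xs) auto
  moreover have "\<forall>j\<in>set ns. j < 0"
    by (simp add: ns_def)
  ultimately have ns: "sum_list (map uminus ns) \<le> int ?M"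
    by (metis of_nat_mono)
  have neg: "\<forall>j\<in>set (map uminus ns). 0 < j" and pos: "\<forall>j\<in>set ps. 0 < j"
    by (auto simp: ns_def ps_def)
  have sum_neg: "sum_list (map uminus xs) = - sum_list xs" for xs :: "int list"
    by (induction xs) auto
  have ps: "sum_list ps \<le> int ?M"
    using split[of "\<lambda>x. x"] js(2) ns by (simp add: sum_neg)
  have len: "length js = length ns + length ps"
    using split[of "\<lambda>_. 1"] by (simp add: sum_list_triv)
  have "int (length js) \<le> 2 * int ?M"
    using len positive_list_bounds(1)[OF neg] positive_list_bounds(1)[OF pos] ns ps
    unfolding length_map by linarith
  then have "length js \<le> 2 * ?M"
    by linarith
  moreover have "j \<in> {- int ?M..int ?M}" if "j \<in> set js" for j
  proof (cases "j < 0")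
    case True
    then have "- j \<in> set (map uminus ns)" using that by (simp add: ns_def)
    then show ?thesis
      using positive_list_bounds(2)[OF neg] ns True by fastforce
  next
    case False
    then have "j \<in> set ps" using that js(1) by (cases "j = 0") (auto simp: ps_def)
    then show ?thesis
      using positive_list_bounds(2)[OF pos] ps False by fastforce
  qed
  ultimately show ?thesis
    using js by (auto simp: relevant_lists_def)
qed

section \<open>Expansion of \<open>F_op\<close> in normally ordered products\<close>

lemma varsigma_nth: "fps_nth (varsigma a) n = ((a / 2) ^ n - (- (a / 2)) ^ n) / fact n"
  by (simp add: varsigma_def diff_divide_distrib)

lemma varsigma_factor: "varsigma a = fps_X * fps_shift 1 (varsigma a)"
  by (rule fps_ext) (simp add: varsigma_nth)

lemma varsigma_nth_1: "fps_nth (varsigma a) 1 = a"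
  by (simp add: varsigma_nth)

text \<open>The coefficient of \<open>:J\<^bsub>j\<^sub>1\<^esub> \<cdots> J\<^bsub>j\<^sub>N\<^esub>:\<close> in \<open>\<E>\<^sub>n(u)\<close>, without the factor \<open>1 / (N! u)\<close>.\<close>

definition E_coeff :: "int list \<Rightarrow> 'c::field_char_0 fps" where
  "E_coeff js = inverse (fps_shift 1 (varsigma 1)) *
     (\<Prod>j\<leftarrow>js. fps_const (1 / of_int j) * varsigma (of_int j))"

text \<open>Each factor \<varsigma>(j u)/j is \<open>u (1 + O(u))\<close> and
  \<open>u\<close>/\<varsigma>(u) is \<open>1 + O(u)\<close>, so the product is
  \<open>u ^ length js\<close> times a series with constant term \<open>1\<close>.\<close>

lemma E_coeff_nth:
  assumes "0 \<notin> set js"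
  shows "n < length js \<Longrightarrow> fps_nth (E_coeff js :: 'c::field_char_0 fps) n = 0"
    and "fps_nth (E_coeff js :: 'c fps) (length js) = 1"
proof -
  have "\<exists>Q. (\<Prod>j\<leftarrow>js. fps_const (1 / of_int j) * varsigma (of_int j)) = fps_X ^ length js * Q \<and>
      fps_nth (Q :: 'c fps) 0 = 1"
    using assms
  proof (induction js)
    case (Cons j js)
    then obtain Q :: "'c fps" where Q:
      "(\<Prod>j\<leftarrow>js. fps_const (1 / of_int j) * varsigma (of_int j)) = fps_X ^ length js * Q" "fps_nth Q 0 = 1"
      by auto
    let ?Q = "fps_const (1 / of_int j) * fps_shift 1 (varsigma (of_int j)) * Q"
    have "(\<Prod>j\<leftarrow>j # js. fps_const (1 / of_int j) * varsigma (of_int j)) = fps_X ^ length (j # js) * ?Q"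
      unfolding list.map prod_list.Cons Q by (subst varsigma_factor) (simp add: mult_ac)
    moreover have "fps_nth ?Q 0 = 1"
      using Cons.prems Q(2) varsigma_nth_1[of "of_int j :: 'c"] by simp
    ultimately show ?case by blast
  qed simp
  then obtain Q where Q: "E_coeff js = fps_X ^ length js * (inverse (fps_shift 1 (varsigma 1)) * Q)" "fps_nth (Q :: 'c fps) 0 = 1"
    by (auto simp: E_coeff_def mult_ac)
  show "n < length js \<Longrightarrow> fps_nth (E_coeff js :: 'c fps) n = 0"
    and "fps_nth (E_coeff js :: 'c fps) (length js) = 1"
    using Q(2) varsigma_nth_1[of "1 :: 'c"] unfolding Q(1) by (simp_all add: fps_X_power_mult_nth)
qed

lemma fls_const_sum: "fls_const (sum h A) = (\<Sum>x\<in>A. fls_const (h x))"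
  by (induction A rule: infinite_finite_induct) (simp_all flip: fls_plus_const)

lemma fps_map_fls_const_mult:
  "fps_map fls_const (f * g) = fps_map fls_const f * fps_map fls_const (g :: 'a::comm_ring_1 fps)"
  by (rule fps_ext) (simp add: fps_mult_nth fls_const_sum)

lemma fps_map_fls_const_1: "fps_map fls_const (1 :: 'a::comm_ring_1 fps) = 1"
  by (rule fps_ext) simp

lemma fact_fls: "(fact n :: 'a::field_char_0 fls) = fls_const (fact n)"
  by (metis fls_of_nat of_nat_fact)

lemma varsigma_fls_const: "varsigma (fls_const a) = fps_map fls_const (varsigma a)"
proof (rule fps_ext)
  fix n
  have "fls_const (((a / 2) ^ n - (- (a / 2)) ^ n) / fact n)
      = (fls_const (a / 2) ^ n - fls_const (- (a / 2)) ^ n) / fls_const (fact n)"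
    by (simp only: fls_const_power[symmetric] fls_minus_const fls_const_divide_const)
  moreover have "fls_const (a / 2) = fls_const a / 2"
    by (metis fls_const_divide_const fls_const_numeral)
  ultimately show "fps_nth (varsigma (fls_const a)) n = fps_nth (fps_map fls_const (varsigma a)) n"
    by (simp only: varsigma_nth fps_nth_fps_map fact_fls fls_const_uminus)
qed

text \<open>Over Laurent series in \<hbar> these universal coefficients are constants in \<hbar>,
  hence they commute with extracting powers of \<hbar>.\<close>

lemma E_coeff_fls: "(E_coeff js :: 'a::field_char_0 fls fps) = fps_map fls_const (E_coeff js)"
proof -
  let ?t = "fps_shift 1 (varsigma 1) :: 'a fps"
  have t0: "fps_nth ?t 0 = 1"
    using varsigma_nth_1[of "1::'a"] by simp
  have t: "fps_shift 1 (varsigma 1) = fps_map fls_const ?t"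
    using varsigma_fls_const[of "1::'a"] by (intro fps_ext) simp
  have "fps_map fls_const ?t * fps_map fls_const (inverse ?t) = 1"
    using t0 by (simp add: inverse_mult_eq_1' fps_map_fls_const_1 flip: fps_map_fls_const_mult)
  then have inv: "inverse (fps_shift 1 (varsigma 1)) = fps_map fls_const (inverse ?t)"
    unfolding t by (rule fps_inverse_unique)
  have "(\<Prod>j\<leftarrow>js. fps_const (1 / of_int j) * varsigma (of_int j))
      = fps_map fls_const (\<Prod>j\<leftarrow>js. fps_const (1 / of_int j) * varsigma (of_int j :: 'a))"
  proof (induction js)
    case (Cons j js)
    have "fps_const (1 / of_int j) = fps_map fls_const (fps_const (1 / of_int j :: 'a))"
      by (rule fps_ext) (simp add: fls_of_int fls_const_divide_const flip: fls_const_1)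
    moreover have "varsigma (of_int j) = fps_map fls_const (varsigma (of_int j :: 'a))"
      by (simp add: fls_of_int varsigma_fls_const)
    ultimately show ?case
      using Cons by (simp add: fps_map_fls_const_mult)
  qed (simp add: fps_map_fls_const_1)
  then show ?thesis
    by (simp only: E_coeff_def inv fps_map_fls_const_mult)
qed

lemma F_op_expand:
  fixes f :: "'c::field_char_0 fock"
  shows "F_op r k f \<mu> = (\<Sum>js\<in>relevant_lists k \<mu>.
     fact r / fact (length js) * fps_nth (E_coeff js) (Suc r) * normal_ordered js f \<mu>)"
proof -
  let ?L = "relevant_lists k \<mu>"
  define P :: "int list \<Rightarrow> 'c fps" where "P = (\<lambda>js. \<Prod>j\<leftarrow>js. fps_const (1 / of_int j) * varsigma (of_int j))"
  define t where "t = fps_shift 1 (varsigma (1::'c))"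
  have t0: "fps_nth t 0 = 1"
    using varsigma_nth_1[of "1::'c"] by (simp add: t_def)
  define T where "T = (\<lambda>js. fps_to_fls (P js) * fls_const (normal_ordered js f \<mu>))"
  have any: "Sum_any (\<lambda>js :: int list.
         if length js = N \<and> 0 \<notin> set js \<and> sum_list js = - int k then T js else 0)
      = (\<Sum>js\<in>{js \<in> ?L. length js = N}. T js)" for N
  proof -
    have "Sum_any (\<lambda>js :: int list. if length js = N \<and> 0 \<notin> set js \<and> sum_list js = - int k then T js else 0)
       = (\<Sum>js\<in>{js \<in> ?L. length js = N}. if length js = N \<and> 0 \<notin> set js \<and> sum_list js = - int k then T js else 0)"
    proof (rule Sum_any.expand_superset)
      show "{js. (if length js = N \<and> 0 \<notin> set js \<and> sum_list js = - int k then T js else 0) \<noteq> 0}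
          \<subseteq> {js \<in> ?L. length js = N}"
        using normal_ordered_support[of _ f \<mu> k] by (auto simp: T_def split: if_splits)
    qed simp
    also have "\<dots> = (\<Sum>js\<in>{js \<in> ?L. length js = N}. T js)"
      by (intro sum.cong) (auto simp: relevant_lists_def)
    finally show ?thesis .
  qed
  have "suminf (\<lambda>N. fls_const (1 / fact N) * (\<Sum>js\<in>{js \<in> ?L. length js = N}. T js))
      = (\<Sum>N\<le>2 * sum_mset \<mu>. fls_const (1 / fact N) * (\<Sum>js\<in>{js \<in> ?L. length js = N}. T js))"
  proof (rule suminf_finite)
    fix N assume "N \<notin> {..2 * sum_mset \<mu>}"
    then have "{js \<in> ?L. length js = N} = {}" by (auto simp: relevant_lists_def)
    then show "fls_const (1 / fact N) * (\<Sum>js\<in>{js \<in> ?L. length js = N}. T js) = 0"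
      by (simp only: sum.empty mult_zero_right)
  qed simp
  also have "\<dots> = (\<Sum>N\<le>2 * sum_mset \<mu>. \<Sum>js\<in>{js \<in> ?L. length js = N}. fls_const (1 / fact (length js)) * T js)"
    by (simp add: sum_distrib_left)
  also have "\<dots> = (\<Sum>js\<in>?L. fls_const (1 / fact (length js)) * T js)"
    by (rule sum.group[OF finite_relevant_lists]) (auto simp: relevant_lists_def)
  finally have E: "E_op (- int k) f \<mu> = 1 / fps_to_fls (varsigma 1) * (\<Sum>js\<in>?L. fls_const (1 / fact (length js)) * T js)"
    unfolding E_op_def any[unfolded T_def P_def] T_def P_def by simp
  \<comment> \<open>As \<open>varsigma 1\<close> is \<open>u * t\<close> with \<open>t\<close>
    invertible, dividing by it leaves one division by \<open>u\<close>; hence the index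
    \<open>Suc r\<close> in the result.\<close>
  have "fps_to_fls t * fps_to_fls (inverse t) = 1"
    using t0 by (simp add: inverse_mult_eq_1' flip: fls_times_fps_to_fls)
  moreover have "fps_to_fls (varsigma 1) = fls_X * fps_to_fls t"
    unfolding t_def by (subst varsigma_factor) (simp add: fls_times_fps_to_fls)
  moreover have "1 / (x * a) = i / x" if "a * i = 1" for x a i :: "'c fls"
    using inverse_unique[OF that] by (simp add: divide_inverse mult.commute)
  ultimately have "1 / fps_to_fls (varsigma (1::'c)) = fps_to_fls (inverse t) / fls_X"
    by simp
  then have "E_op (- int k) f \<mu> = (\<Sum>js\<in>?L. fls_const (1 / fact (length js)) * (fps_to_fls (inverse t) * T js)) / fls_X"
    unfolding E sum_divide_distrib by (simp add: sum_distrib_left mult_ac del: fls_divide_X)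
  also have "\<dots> = (\<Sum>js\<in>?L. fls_const (1 / fact (length js)) * (fls_const (normal_ordered js f \<mu>) * fps_to_fls (E_coeff js))) / fls_X"
    by (simp add: T_def E_coeff_def P_def t_def fls_times_fps_to_fls mult_ac)
  finally have "fls_nth (E_op (- int k) f \<mu>) (int r)
      = (\<Sum>js\<in>?L. 1 / fact (length js) * (normal_ordered js f \<mu> * fps_nth (E_coeff js) (Suc r)))"
    by (simp add: fls_nth_sum nat_add_distrib)
  then show ?thesis
    by (simp add: F_op_def sum_distrib_left mult_ac)
qed

lemma hcoeff_F_op:
  fixes f :: "'a::field_char_0 fls fock"
  shows "hcoeff d (F_op r k f) \<mu> = (\<Sum>js\<in>relevant_lists k \<mu>.
     fact r / fact (length js) * fps_nth (E_coeff js) (Suc r) * normal_ordered js (hcoeff (d + wt js) f) \<mu>)"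
proof -
  have "fls_nth (fact r / fact (length js) * fps_nth (E_coeff js) (Suc r) * normal_ordered js f \<mu>) (d - int (size \<mu>))
      = fact r / fact (length js) * fps_nth (E_coeff js) (Suc r) * normal_ordered js (hcoeff (d + wt js) f) \<mu>"
    if "js \<in> relevant_lists k \<mu>" for js
  proof -
    have "0 \<notin> set js"
      using that by (simp add: relevant_lists_def)
    then have "hcoeff d (normal_ordered js f) \<mu> = normal_ordered js (hcoeff (d + wt js) f) \<mu>"
      by (simp add: hcoeff_normal_ordered)
    then show ?thesis
      unfolding fact_fls E_coeff_fls[where 'a = 'a] by (simp add: fls_const_divide_const hcoeff_def)
  qed
  then show ?thesis
    unfolding hcoeff_def[of d] F_op_expand fls_nth_sum by simp
qed

section \<open>Tuples of extremal weight\<close>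

lemma length_eq_wt:
  assumes "0 \<notin> set js"
  shows "int (length js) = wt js + 2 * int (length (filter (\<lambda>j. j < 0) js))"
  using assms by (induction js) (auto simp: wt_def sgn_if)

lemma negative_entry_exists:
  assumes "sum_list js < (0::int)"
  shows "filter (\<lambda>j. j < 0) js \<noteq> []"
proof
  assume "filter (\<lambda>j. j < 0) js = []"
  then have "\<forall>j\<in>set js. 0 \<le> j" by (auto simp: filter_empty_conv not_less)
  then have "0 \<le> sum_list js" by (induction js) auto
  with assms show False by simp
qed

text \<open>The total \<open>- int k\<close> is negative, so at least one entry is negative, and
  each negative entry costs 2 in the difference of length and weight.\<close>

lemma wt_relevant_le:
  assumes "js \<in> relevant_lists k \<mu>" "k \<ge> 1"
  shows "wt js \<le> int (length js) - 2"
  using assms negative_entry_exists[of js] length_eq_wt[of js]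
  by (cases "filter (\<lambda>j. j < 0) js") (auto simp: relevant_lists_def)

lemma normal_ordered_insert_neg:
  assumes "\<forall>j\<in>set us. 0 < j" "\<forall>j\<in>set vs. 0 < j" "0 < j"
  shows "normal_ordered (us @ - int j # vs) f \<mu> = (if j \<in># \<mu> then foldr J (us @ vs) f (\<mu> - {#j#}) else 0)"
proof -
  have "filter (\<lambda>j. j < 0) us = []" "filter (\<lambda>j. j < 0) vs = []"
    "filter (\<lambda>j. 0 < j) us = us" "filter (\<lambda>j. 0 < j) vs = vs"
    using assms by (auto simp: filter_empty_conv filter_id_conv)
  then show ?thesis
    using assms(3) by (simp add: normal_ordered_def J_neg)
qed

text \<open>Length and weight force exactly one negative entry \<open>- int j\<close>; the others
  form a composition of \<open>j - k\<close>. Normal ordering forgets the position of that entry,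
  and the \<open>Suc r\<close> possible positions give the factor.\<close>

lemma sum_single_negative:
  fixes h :: "'c::comm_ring_1 fock"
  assumes k: "k \<ge> 1"
  shows "(\<Sum>js\<in>{js \<in> relevant_lists k \<mu>. length js = Suc r \<and> wt js = int r - 1}. normal_ordered js h \<mu>)
     = of_nat (Suc r) * (\<Sum>j\<in>set_mset \<mu>. \<Sum>js\<in>positive_lists r (int j - int k). foldr J js h (\<mu> - {#j#}))"
proof -
  let ?A = "{js \<in> relevant_lists k \<mu>. length js = Suc r \<and> wt js = int r - 1}"
  define P where "P = (SIGMA j:set_mset \<mu>. positive_lists r (int j - int k))"
  define F where "F = (\<lambda>(i, j, js). take i js @ - int j # drop i js)"
  have P: "0 < j" "j \<in># \<mu>" "\<forall>x\<in>set js. 0 < x" "length js = r" "sum_list js = int j - int k"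
    "\<forall>x\<in>set js. x \<le> int j - int k" "int r \<le> int j - int k" if "(j, js) \<in> P" for j js
    using that k positive_list_bounds[of js] by (auto simp: P_def positive_lists_def)
  have F: "normal_ordered (F (i, j, js)) h \<mu> = foldr J js h (\<mu> - {#j#})" if "(j, js) \<in> P" for i j js
    using P[OF that] set_take_subset[of i js] set_drop_subset[of i js]
    by (simp add: F_def normal_ordered_insert_neg subset_iff)
  have inj: "inj_on F ({..r} \<times> P)"
  proof (rule inj_onI)
    fix x x' assume "x \<in> {..r} \<times> P" "x' \<in> {..r} \<times> P" and eq: "F x = F x'"
    then obtain i j js i' j' js' where x: "x = (i, j, js)" "x' = (i', j', js')"
      and i: "i \<le> r" "i' \<le> r" and p: "(j, js) \<in> P" and p': "(j', js') \<in> P"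
      by (cases x; cases x') auto
    \<comment> \<open>The position of the negative entry is the length of the longest positive
      prefix; the two filters recover the other data.\<close>
    have recover: "filter (\<lambda>x. x < 0) (F (i, j, js)) = [- int j] \<and> filter (\<lambda>x. 0 < x) (F (i, j, js)) = js
        \<and> length (takeWhile (\<lambda>x. 0 < x) (F (i, j, js))) = i" if "(j, js) \<in> P" "i \<le> r" for i j js
    proof -
      have "\<forall>x\<in>set (take i js). 0 < x" "\<forall>x\<in>set (drop i js). 0 < x"
        using P[OF that(1)] set_take_subset[of i js] set_drop_subset[of i js] by auto
      then have "filter (\<lambda>j. j < 0) (take i js) = []" "filter (\<lambda>j. j < 0) (drop i js) = []"
        "filter (\<lambda>j. 0 < j) (take i js) = take i js" "filter (\<lambda>j. 0 < j) (drop i js) = drop i js"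
        "takeWhile (\<lambda>j. 0 < j) (take i js) = take i js"
        by (auto simp: filter_empty_conv filter_id_conv takeWhile_eq_all_conv)
      then show ?thesis
        using P[OF that(1)] that(2) \<open>\<forall>x\<in>set (take i js). 0 < x\<close>
        by (simp add: F_def takeWhile_append2)
    qed
    note eq = eq[unfolded x]
    have "[- int j] = [- int j']" "js = js'" "i = i'"
      using recover[OF p i(1), unfolded eq] recover[OF p' i(2)] by metis+
    then show "x = x'" by (simp add: x)
  qed
  have sub: "F ` ({..r} \<times> P) \<subseteq> ?A"
  proof (rule image_subsetI)
    fix x assume "x \<in> {..r} \<times> P"
    then obtain i j js where x: "x = (i, j, js)" and i: "i \<le> r" and p: "(j, js) \<in> P"
      by (cases x) auto
    note p = P[OF p]
    let ?M = "int (sum_mset \<mu>)"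
    have jM: "int j \<le> ?M"
      using member_le_sum_mset[OF p(2)] by linarith
    have "set (take i js) \<union> set (drop i js) = set js"
      by (metis append_take_drop_id set_append)
    then have set: "set (F x) = insert (- int j) (set js)"
      by (auto simp: F_def x)
    have "0 \<notin> set js"
      using p(3) by auto
    then have "wt js = int r"
      using p(3,4) length_eq_wt[of js] by (simp add: filter_False not_less less_imp_le)
    moreover have "wt (take i js) + wt (drop i js) = wt js"
      unfolding wt_def by (metis append_take_drop_id map_append sum_list_append)
    ultimately have "wt (F x) = int r - 1"
      using p(1) by (simp add: F_def x wt_def)
    moreover have "sum_list (take i js) + sum_list (drop i js) = sum_list js"
      by (metis append_take_drop_id sum_list_append)
    then have "sum_list (F x) = - int k"
      using p(5) by (simp add: F_def x)
    moreover have len: "length (F x) = Suc r"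
      using p(4) by (simp add: F_def x)
    moreover have "Suc r \<le> 2 * sum_mset \<mu>"
      using p(7) jM k by linarith
    moreover have "0 \<notin> set (F x)"
      using p(1,3) by (auto simp: set)
    moreover have "set (F x) \<subseteq> {- ?M..?M}"
    proof
      fix y assume "y \<in> set (F x)"
      then have "y = - int j \<or> 0 < y \<and> y \<le> int j - int k"
        using p(3,6) by (auto simp: set)
      then show "y \<in> {- ?M..?M}"
        unfolding atLeastAtMost_iff using jM by linarith
    qed
    ultimately show "F x \<in> ?A"
      by (simp only: relevant_lists_def mem_Collect_eq) simp
  qed
  \<comment> \<open>A tuple with one negative entry lies outside the image only if \<open>j\<close>
    is not in \<mu>, and then multiplication by \<open>p\<^sub>j\<close> contributes nothing at
    \<mu>.\<close>
  have rest: "normal_ordered js h \<mu> = 0" if js: "js \<in> ?A - F ` ({..r} \<times> P)" for js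
  proof (rule ccontr)
    assume nz: "normal_ordered js h \<mu> \<noteq> 0"
    have js0: "0 \<notin> set js" and sum: "sum_list js = - int k" and len: "length js = Suc r"
      using js by (auto simp: relevant_lists_def)
    have "length (filter (\<lambda>j. j < 0) js) = 1"
      using length_eq_wt[OF js0] js by auto
    then obtain m where "filter (\<lambda>j. j < 0) js = [m]"
      by (metis One_nat_def length_0_conv length_Suc_conv)
    then obtain us vs where uv: "js = us @ m # vs" "m < 0" "\<forall>u\<in>set us. \<not> u < 0" "[] = filter (\<lambda>j. j < 0) vs"
      by (auto simp: filter_eq_Cons_iff)
    have "\<forall>u\<in>set us. 0 < u" "\<forall>u\<in>set vs. 0 < u"
      using uv js0 by (auto simp: filter_empty_conv dest!: sym[of "[]"] intro: le_neq_trans simp: not_less)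
    moreover define j where "j = nat (- m)"
    moreover have m: "m = - int j" "0 < j"
      using uv(2) by (simp_all add: j_def)
    ultimately have "j \<in># \<mu>"
      using nz normal_ordered_insert_neg[of us vs j h \<mu>] unfolding uv(1) by (auto split: if_splits)
    then have "(j, us @ vs) \<in> P"
      using \<open>\<forall>u\<in>set us. 0 < u\<close> \<open>\<forall>u\<in>set vs. 0 < u\<close> sum len
      unfolding uv(1) m(1) by (auto simp: P_def positive_lists_def)
    moreover have "js = F (length us, j, us @ vs)"
      by (simp add: F_def uv(1) m(1))
    moreover have "length us \<le> r"
      using len uv(1) by simp
    ultimately show False
      using js by auto
  qed
  have fP: "finite P"
    by (simp add: P_def)
  have "(\<Sum>js\<in>?A. normal_ordered js h \<mu>) = (\<Sum>js\<in>F ` ({..r} \<times> P). normal_ordered js h \<mu>)"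
    using sub rest by (intro sum.mono_neutral_right) (auto simp: finite_subset[OF _ finite_relevant_lists])
  also have "\<dots> = (\<Sum>x\<in>{..r} \<times> P. normal_ordered (F x) h \<mu>)"
    using inj by (simp add: sum.reindex)
  also have "\<dots> = (\<Sum>i\<le>r. \<Sum>x\<in>P. normal_ordered (F (i, x)) h \<mu>)"
    by (simp add: sum.cartesian_product)
  also have "\<dots> = (\<Sum>i\<le>r. \<Sum>(j, js)\<in>P. foldr J js h (\<mu> - {#j#}))"
    by (intro sum.cong refl) (auto simp: F)
  also have "\<dots> = of_nat (Suc r) * (\<Sum>(j, js)\<in>P. foldr J js h (\<mu> - {#j#}))"
    by simp
  also have "(\<Sum>(j, js)\<in>P. foldr J js h (\<mu> - {#j#})) = (\<Sum>j\<in>set_mset \<mu>. \<Sum>js\<in>positive_lists r (int j - int k). foldr J js h (\<mu> - {#j#}))"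
    by (simp add: P_def sum.Sigma)
  finally show ?thesis .
qed

section \<open>The action of \<open>W\<close> on states of nonnegative weight\<close>

text \<open>Equivalently, the pole in \<hbar> of the coefficient of \<mu> has order at most
  \<open>size \<mu>\<close>.\<close>

definition regular :: "'a::zero fls fock \<Rightarrow> bool" where
  "regular f \<longleftrightarrow> (\<forall>d<0. hcoeff d f = (\<lambda>_. 0))"

text \<open>A nonzero term needs \<open>length js \<le> Suc r\<close> and
  \<open>d + wt js \<ge> 0\<close>, while the weight is at most the length minus 2. The first bound
  is sharp, and its equality case is a single multiplication with \<open>r\<close> derivations; the
  second is uniform in \<open>r\<close> and serves the convergence of the sum over
  \<open>r\<close>.\<close>

lemma hcoeff_F_op_regular:
  fixes f :: "'a::field_char_0 fls fock"
  assumes f: "regular f" and k: "k \<ge> 1"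
  shows "d < 1 - int r \<Longrightarrow> hcoeff d (F_op r k f) \<mu> = 0"
    and "d < - 2 * int (sum_mset \<mu>) \<Longrightarrow> hcoeff d (F_op r k f) \<mu> = 0"
    and "hcoeff (1 - int r) (F_op r k f) \<mu> =
      (\<Sum>j\<in>set_mset \<mu>. \<Sum>js\<in>positive_lists r (int j - int k). foldr J js (hcoeff 0 f) (\<mu> - {#j#}))"
proof -
  let ?L = "relevant_lists k \<mu>"
  let ?T = "\<lambda>d js. fact r / fact (length js) * fps_nth (E_coeff js) (Suc r) * normal_ordered js (hcoeff (d + wt js) f) \<mu>"
  have zero: "?T d js = 0" if "js \<in> ?L" "length js > Suc r \<or> d + wt js < 0" for d js
  proof -
    have "0 \<notin> set js" using that by (simp add: relevant_lists_def)
    then have "fps_nth (E_coeff js :: 'a fps) (Suc r) = 0 \<or> hcoeff (d + wt js) f = (\<lambda>_. 0)"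
      using that E_coeff_nth(1)[of js "Suc r"] f by (auto simp: regular_def)
    then show ?thesis
      by (auto simp: normal_ordered_zero)
  qed
  show "d < 1 - int r \<Longrightarrow> hcoeff d (F_op r k f) \<mu> = 0"
    unfolding hcoeff_F_op using wt_relevant_le[OF _ k] by (intro sum.neutral ballI zero) force+
  show "d < - 2 * int (sum_mset \<mu>) \<Longrightarrow> hcoeff d (F_op r k f) \<mu> = 0"
    unfolding hcoeff_F_op
  proof (intro sum.neutral ballI zero disjI2)
    fix js assume "d < - 2 * int (sum_mset \<mu>)" "js \<in> ?L"
    moreover have "length js \<le> 2 * sum_mset \<mu>"
      using \<open>js \<in> ?L\<close> by (simp add: relevant_lists_def)
    ultimately show "d + wt js < 0"
      using wt_relevant_le[OF \<open>js \<in> ?L\<close> k] by linarith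
  qed
  let ?A = "{js \<in> ?L. length js = Suc r \<and> wt js = int r - 1}"
  have "hcoeff (1 - int r) (F_op r k f) \<mu> = (\<Sum>js\<in>?A. ?T (1 - int r) js)"
    unfolding hcoeff_F_op
  proof (rule sum.mono_neutral_right)
    show "\<forall>js\<in>?L - ?A. ?T (1 - int r) js = 0"
    proof
      fix js assume js: "js \<in> ?L - ?A"
      then have "wt js \<le> int (length js) - 2"
        using k by (auto intro: wt_relevant_le)
      then have "length js > Suc r \<or> 1 - int r + wt js < 0"
        using js by force
      with js show "?T (1 - int r) js = 0"
        by (intro zero) auto
    qed
  qed auto
  \<comment> \<open>The quotient of factorials is \<open>1 / Suc r\<close>, which the number of
    positions in \<open>sum_single_negative\<close> cancels.\<close>
  also have "\<dots> = (\<Sum>js\<in>?A. 1 / of_nat (Suc r) * normal_ordered js (hcoeff 0 f) \<mu>)"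
  proof (intro sum.cong refl)
    fix js assume js: "js \<in> ?A"
    then have "0 \<notin> set js" by (simp add: relevant_lists_def)
    then have "fps_nth (E_coeff js :: 'a fps) (Suc r) = 1"
      using E_coeff_nth(2)[of js] js by simp
    moreover have "fact r / fact (Suc r) = (1 / of_nat (Suc r) :: 'a)"
      by (simp add: fact_Suc del: of_nat_Suc)
    ultimately show "?T (1 - int r) js = 1 / of_nat (Suc r) * normal_ordered js (hcoeff 0 f) \<mu>"
      using js by (simp del: of_nat_Suc fact_Suc)
  qed
  also have "\<dots> = 1 / of_nat (Suc r) * (\<Sum>js\<in>?A. normal_ordered js (hcoeff 0 f) \<mu>)"
    by (simp only: sum_distrib_left)
  also have "\<dots> = (\<Sum>j\<in>set_mset \<mu>. \<Sum>js\<in>positive_lists r (int j - int k). foldr J js (hcoeff 0 f) (\<mu> - {#j#}))"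
    unfolding sum_single_negative[OF k] by (simp del: of_nat_Suc)
  finally show "hcoeff (1 - int r) (F_op r k f) \<mu> =
      (\<Sum>j\<in>set_mset \<mu>. \<Sum>js\<in>positive_lists r (int j - int k). foldr J js (hcoeff 0 f) (\<mu> - {#j#}))" .
qed

lemma leading_symbol_nth:
  assumes "leading_symbol w wbar"
  shows "n < int r - 1 \<Longrightarrow> fls_nth (w r) n = 0"
    and "fls_nth (w r) (int r - 1) = fps_nth (fps_expansion wbar 0) r"
proof -
  obtain B where B: "w r / fls_X ^ r = fls_const (fps_nth (fps_expansion wbar 0) r) / fls_X + fls_X * fps_to_fls B"
    using assms unfolding leading_symbol_def rescaled_symbol_def by auto
  have "fls_nth (w r) n = fls_nth (fls_const (fps_nth (fps_expansion wbar 0) r) / fls_X + fls_X * fps_to_fls B) (n - int r)" for n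
    unfolding B[symmetric] by simp
  then show "n < int r - 1 \<Longrightarrow> fls_nth (w r) n = 0"
    and "fls_nth (w r) (int r - 1) = fps_nth (fps_expansion wbar 0) r"
    by (simp_all add: fls_X_times_conv_shift)
qed

text \<open>The coefficient \<open>w r\<close> has order at least \<open>r - 1\<close> and
  \<open>F_op r k f\<close> weight at least \<open>1 - r\<close>. These cancel, and in weight
  \<open>0\<close> only the product of the two leading terms remains.\<close>

theorem cut_and_join_regular:
  fixes f :: "'a::field_char_0 fls fock" and \<iota> :: "complex \<Rightarrow> 'a"
  assumes w: "leading_symbol w wbar" and \<iota>: "\<iota> 0 = 0" and f: "regular f" and k: "k \<ge> 1"
  shows "regular (cut_and_join \<iota> w k f)"
    and "hcoeff 0 (cut_and_join \<iota> w k f) = leading_op (fps_map \<iota> (fps_expansion wbar 0)) k (hcoeff 0 f)"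
proof -
  let ?b = "fps_map \<iota> (fps_expansion wbar 0)"
  define g where "g = (\<lambda>\<mu> r. fls_map \<iota> (w r) * F_op r k f \<mu>)"
  have w0: "fls_nth (fls_map \<iota> (w r)) n = 0" if "n < int r - 1" for n r
    using leading_symbol_nth(1)[OF w that] by (simp add: fls_map_nth \<iota>)
  have w1: "fls_nth (fls_map \<iota> (w r)) (int r - 1) = fps_nth ?b r" for r
    using leading_symbol_nth(2)[OF w] by (simp add: fls_map_nth \<iota>)
  have F: "fls_nth (F_op r k f \<mu>) n = hcoeff (n + int (size \<mu>)) (F_op r k f) \<mu>" for r \<mu> n
    by (simp add: hcoeff_def)
  have F0: "fls_nth (F_op r k f \<mu>) n = 0" if "n < 1 - int r - int (size \<mu>)" for r \<mu> n
    using that unfolding F by (intro hcoeff_F_op_regular(1)[OF f k]) simp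
  have F1: "fls_nth (F_op r k f \<mu>) n = 0" if "n < - 2 * int (sum_mset \<mu>) - int (size \<mu>)" for r \<mu> n
    using that unfolding F by (intro hcoeff_F_op_regular(2)[OF f k]) simp
  have g0: "fls_nth (g \<mu> r) n = 0" if "n < - int (size \<mu>)" for \<mu> r n
  proof -
    have "n < (int r - 1) + (1 - int r - int (size \<mu>))" using that by linarith
    then show ?thesis
      unfolding g_def by (rule fls_mult_nth_bounds(1)[OF w0 F0, rotated -1])
  qed
  have g1: "fls_nth (g \<mu> r) (- int (size \<mu>)) = fps_nth ?b r * hcoeff (1 - int r) (F_op r k f) \<mu>" for \<mu> r
    using fls_mult_nth_bounds(2)[where m = "int r - 1" and l = "1 - int r - int (size \<mu>)", OF w0[of _ r] F0[of _ r \<mu>]] unfolding g_def w1 F by simp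
  \<comment> \<open>The order \<open>r - 1\<close> of \<open>w r\<close> and the bound uniform in
    \<open>r\<close> add up to \<open>r - C \<mu>\<close>. For exponents at most \<open>0\<close>,
    \<open>Suc (C \<mu>)\<close> terms then suffice.\<close>
  define C where "C = (\<lambda>\<mu>. Suc (2 * sum_mset \<mu> + size \<mu>))"
  have g2: "fls_nth (g \<mu> r) n = 0" if "n < int r - int (C \<mu>)" for \<mu> r n
  proof -
    have "n < (int r - 1) + (- 2 * int (sum_mset \<mu>) - int (size \<mu>))"
      using that unfolding C_def of_nat_Suc of_nat_add of_nat_mult of_nat_numeral by linarith
    then show ?thesis
      unfolding g_def by (rule fls_mult_nth_bounds(1)[OF w0 F1, rotated -1])
  qed
  have W: "fls_nth (cut_and_join \<iota> w k f \<mu>) n = (\<Sum>r<Suc (C \<mu>). fls_nth (g \<mu> r) n)"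
    if "n \<le> 0" for \<mu> n
    unfolding cut_and_join_def using that fls_suminf_nth[OF g2[of _ _ \<mu>], where n = n and R = "Suc (C \<mu>)"] by (simp add: g_def)
  show "regular (cut_and_join \<iota> w k f)"
    unfolding regular_def hcoeff_def fun_eq_iff by (auto simp: W g0 simp del: sum.lessThan_Suc)
  show "hcoeff 0 (cut_and_join \<iota> w k f) = leading_op ?b k (hcoeff 0 f)"
  proof (rule ext)
    fix \<mu>
    let ?Q = "\<lambda>r j. \<Sum>js\<in>positive_lists r (int j - int k). foldr J js (hcoeff 0 f) (\<mu> - {#j#})"
    have "hcoeff 0 (cut_and_join \<iota> w k f) \<mu> = (\<Sum>r<Suc (C \<mu>). fps_nth ?b r * (\<Sum>j\<in>set_mset \<mu>. ?Q r j))"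
      unfolding hcoeff_def[of 0 "cut_and_join \<iota> w k f"] by (simp only: W g1 hcoeff_F_op_regular(3)[OF f k] diff_0 neg_le_0_iff_le of_nat_0_le_iff)
    also have "\<dots> = (\<Sum>r\<le>sum_mset \<mu>. fps_nth ?b r * (\<Sum>j\<in>set_mset \<mu>. ?Q r j))"
    proof (rule sum.mono_neutral_right)
      show "\<forall>r\<in>{..<Suc (C \<mu>)} - {..sum_mset \<mu>}. fps_nth ?b r * (\<Sum>j\<in>set_mset \<mu>. ?Q r j) = 0"
      proof
        fix r assume r: "r \<in> {..<Suc (C \<mu>)} - {..sum_mset \<mu>}"
        have "positive_lists r (int j - int k) = {}" if "j \<in># \<mu>" for j
          using r member_le_sum_mset[OF that] by (intro positive_lists_empty) auto
        then show "fps_nth ?b r * (\<Sum>j\<in>set_mset \<mu>. ?Q r j) = 0" by simp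
      qed
    qed (auto simp: C_def)
    also have "\<dots> = leading_op ?b k (hcoeff 0 f) \<mu>"
      unfolding leading_op_def sum_distrib_left by (rule sum.swap)
    finally show "hcoeff 0 (cut_and_join \<iota> w k f) \<mu> = leading_op ?b k (hcoeff 0 f) \<mu>" .
  qed
qed

section \<open>The one-point function to leading order\<close>

lemma source_eq_sum:
  "source s f \<mu> = (\<Sum>q\<in>set_mset \<mu> - {0}. fls_const (s q) / (of_nat q * fls_X) * f (\<mu> - {#q#}))"
proof -
  let ?c = "\<lambda>q. fls_const (s q) / (of_nat q * fls_X)"
  have J: "J (- int (Suc i)) f \<mu> = (if Suc i \<in># \<mu> then f (\<mu> - {#Suc i#}) else 0)" for i
    by (rule J_neg) simp
  have "source s f \<mu> = (\<Sum>i\<in>{i. Suc i \<in># \<mu>}. ?c (Suc i) * (if Suc i \<in># \<mu> then f (\<mu> - {#Suc i#}) else 0))"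
    unfolding source_def Let_def J
  proof (rule suminf_finite)
    show "finite {i. Suc i \<in># \<mu>}"
      using finite_vimageI[of "set_mset \<mu>" Suc] by (simp add: vimage_def)
  qed auto
  also have "\<dots> = (\<Sum>q\<in>set_mset \<mu> - {0}. ?c q * f (\<mu> - {#q#}))"
    by (rule sum.reindex_bij_witness[of _ "\<lambda>q. q - 1" Suc]) auto
  finally show ?thesis .
qed

text \<open>Each application of \<open>source\<close> adds one part and one factor 1/\<hbar>, so the
  \<open>n\<close>-th power is \<open>n!\<close> times the part of the exponential with
  \<open>n\<close> factors.\<close>

lemma source_power_vacuum:
  "(source s ^^ n) vacuum \<mu> =
    (if size \<mu> = n then fls_const (fact n * coherent (S_series s) \<mu>) / fls_X ^ n else 0)"
proof (induction n arbitrary: \<mu>)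
  case 0
  then show ?case
    by (simp add: vacuum_def coherent_def sym_factor_def)
next
  case (Suc n)
  let ?S = "S_series s"
  have sz: "size \<mu> = Suc (size (\<mu> - {#q#}))" if "q \<in># \<mu>" for q
    using that by (metis insert_DiffM size_add_mset)
  have step: "(source s ^^ Suc n) vacuum \<mu> = (\<Sum>q\<in>set_mset \<mu> - {0}. fls_const (s q) / (of_nat q * fls_X) *
      (if size (\<mu> - {#q#}) = n then fls_const (fact n * coherent ?S (\<mu> - {#q#})) / fls_X ^ n else 0))"
    by (simp add: source_eq_sum Suc)
  show ?case
  proof (cases "size \<mu> = Suc n")
    case False
    then have "size (\<mu> - {#q#}) \<noteq> n" if "q \<in> set_mset \<mu> - {0}" for q
      using sz[of q] that by auto
    then show ?thesis
      using False unfolding step by (simp add: sum.neutral)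
  next
    case True
    have "(source s ^^ Suc n) vacuum \<mu> = (\<Sum>q\<in>set_mset \<mu> - {0}. fls_const (of_nat (count \<mu> q) * (fact n * coherent ?S \<mu>)) / fls_X ^ Suc n)"
      unfolding step
    proof (intro sum.cong refl)
      fix q assume q: "q \<in> set_mset \<mu> - {0}"
      then have "size (\<mu> - {#q#}) = n"
        using sz[of q] True by auto
      moreover have "of_nat (count \<mu> q) * coherent ?S \<mu> = s q / of_nat q * coherent ?S (\<mu> - {#q#})"
      proof -
        have "Suc (count (\<mu> - {#q#}) q) = count \<mu> q"
          using q by simp
        then show ?thesis
          using coherent_add_mset[of q "\<mu> - {#q#}" ?S] q by (simp add: S_series_def)
      qed
      then have "of_nat (count \<mu> q) * (fact n * coherent ?S \<mu>) = s q / of_nat q * (fact n * coherent ?S (\<mu> - {#q#}))"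
        by (metis mult.left_commute)
      ultimately show "fls_const (s q) / (of_nat q * fls_X) *
          (if size (\<mu> - {#q#}) = n then fls_const (fact n * coherent ?S (\<mu> - {#q#})) / fls_X ^ n else 0)
        = fls_const (of_nat (count \<mu> q) * (fact n * coherent ?S \<mu>)) / fls_X ^ Suc n"
        by (simp add: fls_of_nat fls_const_mult_const[symmetric] fls_const_divide_const[symmetric] del: fls_const_mult_const fls_divide_X fls_divide_X_power)
    qed
    also have "\<dots> = fls_const (\<Sum>q\<in>set_mset \<mu> - {0}. of_nat (count \<mu> q) * (fact n * coherent ?S \<mu>)) / fls_X ^ Suc n"
      by (simp only: sum_divide_distrib fls_const_sum)
    \<comment> \<open>The multiplicities add up to the size \<open>Suc n\<close>, which raises the
      factorial by one; if \<mu> contains \<open>0\<close>, both sides vanish.\<close>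
    also have "(\<Sum>q\<in>set_mset \<mu> - {0}. of_nat (count \<mu> q) * (fact n * coherent ?S \<mu>)) = fact (Suc n) * coherent ?S \<mu>"
    proof (cases "0 \<in># \<mu>")
      case True
      then show ?thesis by (simp add: coherent_containing_0)
    next
      case False
      have "(\<Sum>q\<in>set_mset \<mu>. of_nat (count \<mu> q)) = (of_nat (Suc n) :: 'a)"
        unfolding \<open>size \<mu> = Suc n\<close>[symmetric] size_multiset_overloaded_eq by simp
      moreover have "set_mset \<mu> - {0} = set_mset \<mu>"
        using False by auto
      ultimately show ?thesis
        by (simp only: sum_distrib_right[symmetric] fact_Suc mult.assoc)
    qed
    finally show ?thesis
      using True by (simp only: if_True simp_thms)
  qed
qed

lemma op_exp_source_vacuum:
  "op_exp (source s) vacuum \<mu> = fls_const (coherent (S_series s) \<mu>) / fls_X ^ size \<mu>"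
proof -
  have "op_exp (source s) vacuum \<mu> = (\<Sum>n\<in>{size \<mu>}. (source s ^^ n) vacuum \<mu> / fact n)"
    unfolding op_exp_def by (rule suminf_finite) (simp_all add: source_power_vacuum)
  also have "\<dots> = fls_const (fact (size \<mu>) * coherent (S_series s) \<mu>) / fact (size \<mu>) / fls_X ^ size \<mu>"
    by (simp add: source_power_vacuum divide_divide_eq_left mult.commute del: fls_divide_X_power)
  also have "fls_const (fact (size \<mu>) * coherent (S_series s) \<mu>) / fact (size \<mu>) = fls_const (coherent (S_series s) \<mu>)"
    unfolding fact_fls by (simp add: fls_const_divide_const)
  finally show ?thesis .
qed

lemma hcoeff_op_exp_source:
  "hcoeff d (op_exp (source s) vacuum) = (if d = 0 then coherent (S_series s) else (\<lambda>_. 0))"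
  by (rule ext) (simp add: hcoeff_def op_exp_source_vacuum)

lemma regular_op_exp_source: "regular (op_exp (source s) vacuum)"
  by (simp add: regular_def hcoeff_op_exp_source)

section \<open>The degree grading and finiteness of the exponential of \<open>W\<close>\<close>

definition vanishes_below :: "int \<Rightarrow> 'c::zero fock \<Rightarrow> bool" where
  "vanishes_below c f \<longleftrightarrow> (\<forall>\<mu>. int (sum_mset \<mu>) < c \<longrightarrow> f \<mu> = 0)"

lemma vanishes_below_foldr_J:
  assumes "vanishes_below c f" "0 \<notin> set js"
  shows "vanishes_below (c - sum_list js) (foldr J js f)"
  using assms(2)
proof (induction js)
  case Nil
  then show ?case using assms(1) by simp
next
  case (Cons j js)
  define g where "g = foldr J js f"
  have g: "g \<mu> = 0" if "int (sum_mset \<mu>) < c - sum_list js" for \<mu>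
    using Cons that by (simp add: g_def vanishes_below_def)
  have "J j g \<mu> = 0" if \<mu>: "int (sum_mset \<mu>) < c - sum_list (j # js)" for \<mu>
  proof (cases "j < 0")
    case True
    have "g (\<mu> - {#nat (- j)#}) = 0" if "nat (- j) \<in># \<mu>"
    proof (rule g)
      have "sum_mset \<mu> = nat (- j) + sum_mset (\<mu> - {#nat (- j)#})"
        using that by (metis insert_DiffM sum_mset.add_mset)
      then have "int (sum_mset \<mu>) = - j + int (sum_mset (\<mu> - {#nat (- j)#}))"
        using True by (simp only: of_nat_add)
      then show "int (sum_mset (\<mu> - {#nat (- j)#})) < c - sum_list js"
        using \<mu> unfolding sum_list.Cons by linarith
    qed
    then show ?thesis
      using True by (simp add: J_def)
  next
    case False
    have "g (add_mset (nat j) \<mu>) = 0"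
    proof (rule g)
      have "int (sum_mset (add_mset (nat j) \<mu>)) = j + int (sum_mset \<mu>)"
        using False by (simp only: sum_mset.add_mset of_nat_add)
      then show "int (sum_mset (add_mset (nat j) \<mu>)) < c - sum_list js"
        using \<mu> unfolding sum_list.Cons by linarith
    qed
    then show ?thesis
      using False by (simp add: J_def)
  qed
  then show ?case
    unfolding vanishes_below_def g_def foldr_Cons o_apply by blast
qed

text \<open>Every contributing tuple has total \<open>- int k\<close>, and normal ordering preserves
  the total, so \<open>W\<close> raises by \<open>k\<close> the degree in which
  \<open>p\<^sub>j\<close> counts \<open>j\<close>.\<close>

lemma vanishes_below_cut_and_join:
  assumes f: "vanishes_below c f"
  shows "vanishes_below (c + int k) (cut_and_join \<iota> w k f)"
proof -
  have "normal_ordered js f \<mu> = 0"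
    if \<mu>: "int (sum_mset \<mu>) < c + int k" and js: "js \<in> relevant_lists k \<mu>" for \<mu> js
  proof -
    let ?js = "filter (\<lambda>j. j < 0) js @ filter (\<lambda>j. 0 < j) js"
    have "sum_list ?js = - int k"
      using sum_list_map_normal_order[of js "\<lambda>x. x"] js by (simp add: relevant_lists_def)
    then have "vanishes_below (c + int k) (normal_ordered js f)"
      using vanishes_below_foldr_J[OF f, of ?js] by (simp add: normal_ordered_def)
    then show ?thesis
      using \<mu> by (simp only: vanishes_below_def)
  qed
  then have F: "F_op r k f \<mu> = 0" if "int (sum_mset \<mu>) < c + int k" for r \<mu>
    using that unfolding F_op_expand by (intro sum.neutral ballI) simp
  have "cut_and_join \<iota> w k f \<mu> = 0" if "int (sum_mset \<mu>) < c + int k" for \<mu>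
    unfolding cut_and_join_def F[OF that] by simp
  then show ?thesis
    unfolding vanishes_below_def by blast
qed

lemma cut_and_join_power_eq_0:
  assumes "k \<ge> 1" "sum_mset \<mu> < n"
  shows "(cut_and_join \<iota> w k ^^ n) f \<mu> = 0"
proof -
  have "vanishes_below (int (n * k)) ((cut_and_join \<iota> w k ^^ n) f)"
  proof (induction n)
    case 0
    show ?case
      unfolding vanishes_below_def by (metis mult_0 of_nat_0 of_nat_less_0_iff)
  next
    case (Suc n)
    then show ?case
      using vanishes_below_cut_and_join[OF Suc, of k \<iota> w] by (simp add: algebra_simps)
  qed
  moreover have "sum_mset \<mu> < n * k"
    using assms by (metis less_le_trans mult.right_neutral mult_le_mono2)
  ultimately show ?thesis
    unfolding vanishes_below_def by (metis of_nat_less_iff)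
qed

text \<open>At each \<mu> the exponential is a finite sum by degree, and its terms can be treated
  one by one in weight \<open>0\<close>. The second claim passes the vanishing of high powers of
  \<open>W\<close> on to \<open>L\<close>.\<close>

lemma hcoeff_op_exp_cut_and_join:
  fixes f :: "'a::field_char_0 fls fock" and \<iota> :: "complex \<Rightarrow> 'a"
  assumes w: "leading_symbol w wbar" and \<iota>: "\<iota> 0 = 0" and f: "regular f" and k: "k \<ge> 1"
  defines "L \<equiv> leading_op (fps_map \<iota> (fps_expansion wbar 0)) k"
  shows "hcoeff 0 (op_exp (cut_and_join \<iota> w k) f) \<mu> = (\<Sum>n\<le>sum_mset \<mu>. (L ^^ n) (hcoeff 0 f) \<mu> / fact n)"
    and "sum_mset \<mu> < n \<Longrightarrow> (L ^^ n) (hcoeff 0 f) \<mu> = 0"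
proof -
  let ?W = "cut_and_join \<iota> w k"
  have W: "regular ((?W ^^ n) f) \<and> hcoeff 0 ((?W ^^ n) f) = (L ^^ n) (hcoeff 0 f)" for n
    by (induction n) (simp_all add: f cut_and_join_regular[where \<iota> = \<iota>, OF w \<iota> _ k] L_def)
  show "sum_mset \<mu> < n \<Longrightarrow> (L ^^ n) (hcoeff 0 f) \<mu> = 0"
    using W[of n] cut_and_join_power_eq_0[OF k, of \<mu> n \<iota> w f] by (metis fls_zero_nth hcoeff_def)
  have "op_exp ?W f \<mu> = (\<Sum>n\<le>sum_mset \<mu>. (?W ^^ n) f \<mu> / fact n)"
    unfolding op_exp_def by (rule suminf_finite) (simp_all add: cut_and_join_power_eq_0[OF k])
  moreover have "fls_nth (x / fact n) m = fls_nth x m / fact n" for x :: "'a fls" and n m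
  proof -
    have "x / fact n = fls_const (1 / fact n) * x"
      by (simp add: fact_fls field_simps fls_const_divide_const flip: fls_const_1)
    then show ?thesis by simp
  qed
  moreover have "fls_nth ((?W ^^ n) f \<mu>) (0 - int (size \<mu>)) = (L ^^ n) (hcoeff 0 f) \<mu>" for n
    using W[of n] by (simp only: hcoeff_def[of 0 "(?W ^^ n) f", symmetric]) 
  ultimately show "hcoeff 0 (op_exp ?W f) \<mu> = (\<Sum>n\<le>sum_mset \<mu>. (L ^^ n) (hcoeff 0 f) \<mu> / fact n)"
    by (simp only: hcoeff_def[of 0 "op_exp ?W f"] fls_nth_sum)
qed

text \<open>\<open>J (int m)\<close> followed by the constant term reads off \<open>m\<close> times
  the coefficient of \<open>p\<^sub>m\<close>. This monomial has size 1, so \<hbar> to the power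
  \<open>-1\<close> is weight \<open>0\<close>, where the coherent state at time \<open>1\<close>
  has the coefficient \<open>fps_nth \<phi> m / m\<close>.\<close>

lemma omega1_coeff_leading:
  fixes \<iota> :: "complex \<Rightarrow> 'a::field_char_0"
  assumes w: "leading_symbol w wbar" and \<iota>: "\<iota> 0 = 0" and k: "k \<ge> 1"
    and sol: "burgers_solution (fps_map \<iota> (fps_expansion wbar 0)) k (S_series s) \<phi>" and m: "m \<ge> 1"
  shows "fls_nth (omega1_coeff \<iota> w k s m) (-1) = poly (fps_nth \<phi> m) 1"
proof -
  define f where "f = (op_exp (source s) vacuum :: 'a fls fock)"
  define p where "p = coherent_poly \<phi> {#m#}"
  have f: "regular f" "hcoeff 0 f = coherent (S_series s)"
    by (simp_all add: f_def regular_op_exp_source hcoeff_op_exp_source)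
  have c: "coeff p n = (leading_op (fps_map \<iota> (fps_expansion wbar 0)) k ^^ n) (hcoeff 0 f) {#m#} / fact n" for n
    unfolding p_def f(2) by (rule coeff_coherent_poly_burgers[OF sol k])
  \<comment> \<open>Powers of \<open>L\<close> beyond \<open>m\<close> vanish here, so the truncated
    exponential is the whole polynomial \<open>p\<close>, evaluated at time
    \<open>1\<close>.\<close>
  have "coeff p n = 0" if "m < n" for n
    unfolding c using hcoeff_op_exp_cut_and_join(2)[where \<iota> = \<iota>, OF w \<iota> f(1) k, where \<mu> = "{#m#}" and n = n] that by simp
  then have deg: "degree p \<le> m"
    by (metis degree_le)
  have "hcoeff 0 (op_exp (cut_and_join \<iota> w k) f) {#m#} = (\<Sum>n\<le>m. coeff p n)"
    using hcoeff_op_exp_cut_and_join(1)[where \<iota> = \<iota>, OF w \<iota> f(1) k, where \<mu> = "{#m#}"] by (simp add: c)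
  also have "\<dots> = (\<Sum>n\<le>degree p. coeff p n)"
    using deg by (intro sum.mono_neutral_right) (auto simp: coeff_eq_0)
  also have "\<dots> = poly p 1"
    by (simp add: poly_altdef)
  also have "\<dots> = poly (fps_nth \<phi> m) 1 / of_nat m"
    by (simp add: p_def poly_coherent_poly coherent_def sym_factor_def)
  finally have "fls_nth (op_exp (cut_and_join \<iota> w k) f {#m#}) (-1) = poly (fps_nth \<phi> m) 1 / of_nat m"
    by (simp add: hcoeff_def)
  moreover have "omega1_coeff \<iota> w k s m = of_nat m * op_exp (cut_and_join \<iota> w k) f {#m#}"
    by (simp add: omega1_coeff_def vev_def J_pos f_def)
  ultimately show ?thesis
    using m by (simp add: fls_of_nat)
qed

theorem corollary6p13:
  fixes \<iota> :: "complex \<Rightarrow> 'a::field_char_0"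
    and k :: nat
    and w :: "nat \<Rightarrow> complex fls"
    and wbar :: "complex \<Rightarrow> complex"
    and s :: "nat \<Rightarrow> 'a"
  assumes "\<iota> 1 = 1"
    and "\<And>a b. \<iota> (a + b) = \<iota> a + \<iota> b"
    and "\<And>a b. \<iota> (a * b) = \<iota> a * \<iota> b"
    and "k \<ge> 1"
    and "admissible_symbol w"
    and "leading_symbol w wbar"
    and "wbar analytic_on UNIV"
    and "wbar 0 = 0"
  shows "let wb = fps_map \<iota> (fps_expansion wbar 0); S = S_series s;
             X = curve_X wb k S; y = curve_y wb k S
         in form_pullback (omega01 \<iota> w k s) X = fps_to_fls y * dlog_form X"
proof -
  define b where "b = fps_map \<iota> (fps_expansion wbar 0)"
  define S where "S = S_series s"
  define X where "X = curve_X b k S"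
  have \<iota>0: "\<iota> 0 = 0"
    using assms(2)[of 0 0] by simp
  have S0: "fps_nth S 0 = 0"
    by (simp add: S_def S_series_def)
  have b0: "fps_nth b 0 = 0"
    using assms(8) by (simp add: b_def fps_expansion_def \<iota>0)
  obtain \<phi> where sol: "burgers_solution b k S \<phi>"
    using burgers_solution_exists[OF S0 assms(4)] by blast
  \<comment> \<open>\<open>omega01\<close> sets the coefficient of index \<open>0\<close> to
    \<open>0\<close>, which must match \<phi>.\<close>
  have "fps_nth \<phi> 0 = 0"
    using sol by (simp add: burgers_solution_def)
  then have "omega01 \<iota> w k s = fps_to_fls (at_time 1 \<phi>) / fls_X"
    unfolding omega01_def
    using omega1_coeff_leading[where \<iota> = \<iota>, OF assms(6) \<iota>0 assms(4) sol[unfolded b_def S_def]]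
    by (intro arg_cong2[of _ _ _ _ "(/)"] arg_cong[of _ _ fps_to_fls] fps_ext) auto
  moreover have X0: "fps_nth X 0 = 0" "X \<noteq> 0"
    using curve_X_nth_0[OF S0 assms(4), of b] curve_X_nth_1[OF S0 assms(4), of b] by (auto simp: X_def)
  ultimately have "form_pullback (omega01 \<iota> w k s) X
      = fps_to_fls (fps_compose (at_time 1 \<phi>) X) / fps_to_fls X * fps_to_fls (fps_deriv X)"
    by (simp add: form_pullback_def fls_compose_fps_divide del: fls_divide_X)
  also have "fps_compose (at_time 1 \<phi>) X = curve_y b k S"
    unfolding X_def by (rule burgers_spectral_curve[OF sol assms(4) S0 b0])
  finally show ?thesis
    by (simp add: Let_def dlog_form_def X_def b_def S_def)
qed

end
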